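(* Let $\mathcal{H}=\mathcal{H}_1\oplus\mathcal{H}_2$ be a nontrivial orthogonal decomposition of a complex Hilbert space and suppose $T=\begin{bmatrix} V & E\\ 0 & Q\end{bmatrix}\in\mathcal{Q}_{\mathcal{H}_1,\mathcal{H}_2}$. Then the following conditions are equivalent: (i) $T$ is a Brownian isometry; (ii) $(|Q|^2-I)(|Q|^2+|E|^2-I)=0$ and $(|Q^*|^2-I)(|Q|^2+|E|^2-I)=0$; (iii) there exists an orthogonal decomposition $\mathcal{H}_2=\mathcal{H}_{\mathrm{u}}\oplus\mathcal{H}_{\mathrm{s}}\oplus\mathcal{H}_{\mathrm{si}}$ (zero summands are allowed) such that (a) $\mathcal{H}_{\mathrm{u}}$, $\mathcal{H}_{\mathrm{s}}$ and $\mathcal{H}_{\mathrm{si}}$ reduce both $Q$ and $|E|$, (b) $Q|_{\mathcal{H}_{\mathrm{u}}}$ is a unitary operator and $Q|_{\mathcal{H}_{\mathrm{s}}}$ is a unilateral shift (of finite or infinite multiplicity), (c) $\big(Q|_{\mathcal{H}_{\mathrm{si}}},|E||_{\mathcal{H}_{\mathrm{si}}}\big)$ is a spherical isometry, (d) $|E||_{\mathcal{H}_{\mathrm{s}}}=0$.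
   Context: $B(\mathcal{H},\mathcal{K})$ denotes the bounded linear operators between complex Hilbert spaces, $B(\mathcal{H})=B(\mathcal{H},\mathcal{H})$; $|T|=(T^*T)^{1/2}$. Class $\mathcal{Q}$: an orthogonal decomposition $\mathcal{H}=\mathcal{H}_1\oplus\mathcal{H}_2$ is nontrivial if $\mathcal{H}_1\neq\{0\}$ and $\mathcal{H}_2\neq\{0\}$. For such a decomposition, $T=\begin{bmatrix} V & E\\ 0 & Q\end{bmatrix}\in\mathcal{Q}_{\mathcal{H}_1,\mathcal{H}_2}$ means that $T\in B(\mathcal{H})$ has this block form with $V\in B(\mathcal{H}_1)$, $E\in B(\mathcal{H}_2,\mathcal{H}_1)$, $Q\in B(\mathcal{H}_2)$ satisfying $V^*V=I$, $V^*E=0$, $QE^*E=E^*EQ$, and $Q$ is quasinormal, i.e. $QQ^*Q=Q^*QQ$. (Then $Q$ commutes with $|E|$.) $T\in B(\mathcal{H})$ is a $2$-isometry if $T^{*2}T^2-2T^*T+I=0$; it is a Brownian isometry if it is a $2$-isometry and $\triangle_T\triangle_{T^*}\triangle_T=0$, where $\triangle_T=T^*T-I$ (so $\triangle_{T^*}=TT^*-I$). A pair $(T_1,T_2)$ of commuting operators is a spherical isometry if $T_1^*T_1+T_2^*T_2=I$. *)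

theory Defs
  imports "HOL-Analysis.Analysis"
begin

text \<open>
  A complex Hilbert space is a complete real inner product space with a complex scalar
  multiplication and a complex inner product (linear in the first argument) whose real part
  is the given real inner product, so that norm and topology are the library's.  Positive
  definiteness is inherited, since \<open>cinner x x\<close> is real by conjugate symmetry.
\<close>

class complex_hilbert_space = banach + real_inner +
  fixes scaleC :: "complex \<Rightarrow> 'a \<Rightarrow> 'a" (infixr "*\<^sub>C" 75)
    and cinner :: "'a \<Rightarrow> 'a \<Rightarrow> complex"
  assumes scaleC_add_right: "c *\<^sub>C (x + y) = c *\<^sub>C x + c *\<^sub>C y"
    and scaleC_add_left: "(c + d) *\<^sub>C x = c *\<^sub>C x + d *\<^sub>C x"
    and scaleC_scaleC: "c *\<^sub>C (d *\<^sub>C x) = (c * d) *\<^sub>C x"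
    and scaleC_of_real: "complex_of_real r *\<^sub>C x = r *\<^sub>R x"
    and cinner_commute: "cinner x y = cnj (cinner y x)"
    and cinner_add_left: "cinner (x + y) z = cinner x z + cinner y z"
    and cinner_scaleC_left: "cinner (c *\<^sub>C x) y = c * cinner x y"
    and Re_cinner: "Re (cinner x y) = inner x y"

definition closed_csubspace :: "'a::complex_hilbert_space set \<Rightarrow> bool" where
  "closed_csubspace M \<longleftrightarrow> subspace M \<and> (\<forall>c. \<forall>x\<in>M. c *\<^sub>C x \<in> M) \<and> closed M"

definition corthogonal :: "'a::complex_hilbert_space set \<Rightarrow> 'a set \<Rightarrow> bool" where
  "corthogonal M N \<longleftrightarrow> (\<forall>x\<in>M. \<forall>y\<in>N. cinner x y = 0)"

definition ocomplement :: "'a::complex_hilbert_space set \<Rightarrow> 'a set \<Rightarrow> 'a set" where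
  "ocomplement H M = {x \<in> H. \<forall>y\<in>M. cinner x y = 0}"

definition orth_decomp2 :: "'a::complex_hilbert_space set \<Rightarrow> 'a set \<Rightarrow> 'a set \<Rightarrow> bool" where
  "orth_decomp2 H M N \<longleftrightarrow>
     closed_csubspace M \<and> closed_csubspace N \<and> corthogonal M N \<and>
     H = {x + y | x y. x \<in> M \<and> y \<in> N}"

definition orth_decomp3 ::
    "'a::complex_hilbert_space set \<Rightarrow> 'a set \<Rightarrow> 'a set \<Rightarrow> 'a set \<Rightarrow> bool" where
  "orth_decomp3 H M N P \<longleftrightarrow>
     closed_csubspace M \<and> closed_csubspace N \<and> closed_csubspace P \<and>
     corthogonal M N \<and> corthogonal M P \<and> corthogonal N P \<and>
     H = {x + y + z | x y z. x \<in> M \<and> y \<in> N \<and> z \<in> P}"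

text \<open>
  An operator between closed subspaces \<open>M\<close> and \<open>N\<close> is represented by a function on the ambient
  type of which only the values on \<open>M\<close> matter; identities between such operators are stated
  pointwise on \<open>M\<close>.  Consequently the restriction of an operator to an invariant subspace is
  the same function, considered on the smaller subspace.
\<close>

definition bounded_op ::
    "'a::complex_hilbert_space set \<Rightarrow> 'a set \<Rightarrow> ('a \<Rightarrow> 'a) \<Rightarrow> bool" where
  "bounded_op M N A \<longleftrightarrow>
     (\<forall>x\<in>M. A x \<in> N) \<and>
     (\<forall>x\<in>M. \<forall>y\<in>M. A (x + y) = A x + A y) \<and>
     (\<forall>c. \<forall>x\<in>M. A (c *\<^sub>C x) = c *\<^sub>C A x) \<and>
     (\<exists>K. \<forall>x\<in>M. norm (A x) \<le> K * norm x)"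

text \<open>
  For \<open>A\<close> in \<open>B(M,N)\<close>, \<open>cadj M A\<close> restricted to \<open>N\<close> is the adjoint in \<open>B(N,M)\<close>: the element
  below exists uniquely by the Riesz theorem in \<open>M\<close>.  It does not depend on \<open>N\<close>, which is
  therefore not a parameter.  The domain \<open>M\<close> is essential: adjoints of restrictions are taken
  in the smaller space.
\<close>

definition cadj ::
    "'a::complex_hilbert_space set \<Rightarrow> ('a \<Rightarrow> 'a) \<Rightarrow> 'a \<Rightarrow> 'a" where
  "cadj M A y = (THE x. x \<in> M \<and> (\<forall>m\<in>M. cinner (A m) y = cinner m x))"

definition positive_op :: "'a::complex_hilbert_space set \<Rightarrow> ('a \<Rightarrow> 'a) \<Rightarrow> bool" where
  "positive_op M A \<longleftrightarrow> bounded_op M M A \<and> (\<forall>x\<in>M. cinner (A x) x \<in> \<real>\<^sub>\<ge>\<^sub>0)"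

text \<open>
  The positive square root is unique as an operator on \<open>M\<close>; setting it to zero off \<open>M\<close> makes
  the representing function unique as well.
\<close>

definition op_sqrt :: "'a::complex_hilbert_space set \<Rightarrow> ('a \<Rightarrow> 'a) \<Rightarrow> 'a \<Rightarrow> 'a" where
  "op_sqrt M A = (THE S. positive_op M S \<and> (\<forall>x\<in>M. S (S x) = A x) \<and> (\<forall>x. x \<notin> M \<longrightarrow> S x = 0))"

definition op_abs :: "'a::complex_hilbert_space set \<Rightarrow> ('a \<Rightarrow> 'a) \<Rightarrow> 'a \<Rightarrow> 'a" where
  "op_abs M A = op_sqrt M (cadj M A \<circ> A)"

definition quasinormal :: "'a::complex_hilbert_space set \<Rightarrow> ('a \<Rightarrow> 'a) \<Rightarrow> bool" where
  "quasinormal M A \<longleftrightarrow> bounded_op M M A \<and>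
     (\<forall>x\<in>M. A (cadj M A (A x)) = cadj M A (A (A x)))"

definition class_Q ::
    "'a::complex_hilbert_space set \<Rightarrow> 'a set \<Rightarrow> ('a \<Rightarrow> 'a) \<Rightarrow>
     ('a \<Rightarrow> 'a) \<Rightarrow> ('a \<Rightarrow> 'a) \<Rightarrow> ('a \<Rightarrow> 'a) \<Rightarrow> bool" where
  "class_Q H1 H2 T V E Q \<longleftrightarrow>
     bounded_op UNIV UNIV T \<and>
     bounded_op H1 H1 V \<and> bounded_op H2 H1 E \<and> bounded_op H2 H2 Q \<and>
     (\<forall>x\<in>H1. \<forall>y\<in>H2. T (x + y) = (V x + E y) + Q y) \<and>
     (\<forall>x\<in>H1. cadj H1 V (V x) = x) \<and>
     (\<forall>y\<in>H2. cadj H1 V (E y) = 0) \<and>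
     (\<forall>y\<in>H2. Q (cadj H2 E (E y)) = cadj H2 E (E (Q y))) \<and>
     quasinormal H2 Q"

definition two_isometry :: "'a::complex_hilbert_space set \<Rightarrow> ('a \<Rightarrow> 'a) \<Rightarrow> bool" where
  "two_isometry M T \<longleftrightarrow> bounded_op M M T \<and>
     (\<forall>x\<in>M. cadj M T (cadj M T (T (T x))) - 2 *\<^sub>R cadj M T (T x) + x = 0)"

definition defect_op :: "'a::complex_hilbert_space set \<Rightarrow> ('a \<Rightarrow> 'a) \<Rightarrow> 'a \<Rightarrow> 'a" where
  "defect_op M T x = cadj M T (T x) - x"

definition brownian_isometry :: "'a::complex_hilbert_space set \<Rightarrow> ('a \<Rightarrow> 'a) \<Rightarrow> bool" where
  "brownian_isometry M T \<longleftrightarrow> two_isometry M T \<and>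
     (\<forall>x\<in>M. defect_op M T (defect_op M (cadj M T) (defect_op M T x)) = 0)"

definition reduces ::
    "'a::complex_hilbert_space set \<Rightarrow> 'a set \<Rightarrow> ('a \<Rightarrow> 'a) \<Rightarrow> bool" where
  "reduces H M A \<longleftrightarrow> closed_csubspace M \<and> M \<subseteq> H \<and>
     A ` M \<subseteq> M \<and> A ` ocomplement H M \<subseteq> ocomplement H M"

definition unitary_op :: "'a::complex_hilbert_space set \<Rightarrow> ('a \<Rightarrow> 'a) \<Rightarrow> bool" where
  "unitary_op M U \<longleftrightarrow> bounded_op M M U \<and>
     (\<forall>x\<in>M. cadj M U (U x) = x) \<and> (\<forall>x\<in>M. U (cadj M U x) = x)"

text \<open>
  An isometry \<open>S\<close> is a unilateral shift if the space is the orthogonal sum of the \<open>S^n L\<close> for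
  some closed subspace \<open>L\<close> (a generating wandering subspace); the multiplicity, that is the
  Hilbert dimension of \<open>L\<close>, is arbitrary (zero exactly on the zero space).  The sets \<open>S^n L\<close>
  are complex subspaces, so the real span of their union is also its complex span.
\<close>

definition unilateral_shift :: "'a::complex_hilbert_space set \<Rightarrow> ('a \<Rightarrow> 'a) \<Rightarrow> bool" where
  "unilateral_shift M S \<longleftrightarrow> bounded_op M M S \<and> (\<forall>x\<in>M. cadj M S (S x) = x) \<and>
     (\<exists>L. closed_csubspace L \<and> L \<subseteq> M \<and>
        (\<forall>m n. m \<noteq> n \<longrightarrow> corthogonal ((S ^^ m) ` L) ((S ^^ n) ` L)) \<and>
        M = closure (span (\<Union>n. (S ^^ n) ` L)))"

definition spherical_isometry ::
    "'a::complex_hilbert_space set \<Rightarrow> ('a \<Rightarrow> 'a) \<Rightarrow> ('a \<Rightarrow> 'a) \<Rightarrow> bool" where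
  "spherical_isometry M A B \<longleftrightarrow> bounded_op M M A \<and> bounded_op M M B \<and>
     (\<forall>x\<in>M. A (B x) = B (A x)) \<and>
     (\<forall>x\<in>M. cadj M A (A x) + cadj M B (B x) = x)"

end

theory Submission
  imports Defs
begin

text \<open>
  Put \<open>D = Q\<^sup>*Q + E\<^sup>*E - I\<close> on \<open>H\<^sub>2\<close>; it is selfadjoint and commutes with \<open>Q\<close>, \<open>Q\<^sup>*\<close> and \<open>\<bar>E\<bar>\<close>.
  A block computation gives \<open>T\<^sup>*T - I = 0 \<oplus> D\<close>, so \<open>T\<close> is a 2-isometry iff \<open>(Q\<^sup>*Q - I) D = 0\<close>, and
  then Brownian iff \<open>D (QQ\<^sup>* - I) D = 0\<close>, which by commutation means \<open>(QQ\<^sup>* - I) D = 0\<close>.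
  Given these equations, \<open>ker D\<close> reduces everything and carries the spherical isometry, while \<open>Q\<close> is
  unitary on its complement, so that the shift summand can be taken to be zero.  Conversely \<open>D\<close>
  vanishes on the shift and the spherical summand, and \<open>Q\<close> is unitary on the remaining one.
\<close>

subsection \<open>Complex inner products\<close>

text \<open>\<open>Q\<close> commutes with \<open>D\<close> because quasinormality handles its
  summand \<open>Q\<^sup>*Q\<close> and the definition of the class handles
  \<open>E\<^sup>*E\<close>; taking adjoints gives the same for \<open>Q\<^sup>*\<close>, as
  \<open>D\<close> is selfadjoint. For \<open>\<bar>E\<bar>\<close> one needs that the square root
  of a positive operator commutes with everything that commutes with the operator. This, together
  with the existence and uniqueness that give meaning to the definite description in
  \<open>op_sqrt\<close>, is why square roots are built explicitly as limits of polynomials. The two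
  equations in \<open>D\<close> say that \<open>Q\<^sup>*Q - I\<close> and
  \<open>QQ\<^sup>* - I\<close> map \<open>H\<^sub>2\<close> into \<open>ker D\<close>. Since
  \<open>ker D\<close> reduces \<open>Q\<close>, both also leave its complement invariant, so they
  vanish there. Any shift summand allowed by the third condition lies in \<open>ker D\<close>, where
  \<open>Q\<^sup>*Q + \<bar>E\<bar>\<^sup>2 = I\<close>; it is thus absorbed by the spherical
  summand.\<close>

lemma cinner_add_right: "cinner x (y + z) = cinner x y + cinner x z"
  by (metis cinner_add_left cinner_commute complex_cnj_add)

lemma cinner_scaleC_right: "cinner x (c *\<^sub>C y) = cnj c * cinner x y"
  by (metis cinner_scaleC_left cinner_commute complex_cnj_mult)

lemma cinner_scaleR_left: "cinner (r *\<^sub>R x) y = of_real r * cinner x y"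
  by (metis cinner_scaleC_left scaleC_of_real)

lemma cinner_scaleR_right: "cinner x (r *\<^sub>R y) = of_real r * cinner x y"
  by (metis cinner_scaleC_right scaleC_of_real complex_cnj_complex_of_real)

lemma cinner_minus_left: "cinner (- x) y = - cinner x y"
  using cinner_scaleR_left[of "-1" x y] by simp

lemma cinner_minus_right: "cinner x (- y) = - cinner x y"
  using cinner_scaleR_right[of x "-1" y] by simp

lemma cinner_diff_left: "cinner (x - y) z = cinner x z - cinner y z"
  using cinner_add_left[of x "- y" z] by (simp add: cinner_minus_left)

lemma cinner_diff_right: "cinner x (y - z) = cinner x y - cinner x z"
  using cinner_add_right[of x y "- z"] by (simp add: cinner_minus_right)

lemma cinner_zero_left [simp]: "cinner 0 x = 0"
  using cinner_scaleR_left[of 0 x x] by simp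

lemma cinner_zero_right [simp]: "cinner x 0 = 0"
  using cinner_scaleR_right[of x 0 x] by simp

lemma cinner_self_eq_zero_iff [simp]: "cinner x x = 0 \<longleftrightarrow> x = 0"
  using Re_cinner[of x x] by auto

text \<open>The real inner product determines the complex one. A real identity valid on a complex
  subspace therefore becomes a complex one by also testing it at
  \<open>\<i> *\<^sub>C x\<close>.\<close>

lemma Im_cinner: "Im (cinner x y) = - inner (\<i> *\<^sub>C x) y"
  by (simp add: cinner_scaleC_left flip: Re_cinner)

lemma cinner_self_of_real: "cinner x x = of_real (inner x x)"
proof (rule complex_eqI)
  show "Im (cinner x x) = Im (of_real (inner x x))"
    using arg_cong[OF cinner_commute[of x x], of Im] by simp
qed (simp add: Re_cinner)

lemma norm_scaleC: "norm (c *\<^sub>C x) = cmod c * norm x"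
proof -
  have "of_real ((norm (c *\<^sub>C x))\<^sup>2) = (of_real ((cmod c * norm x)\<^sup>2) :: complex)"
    using cinner_self_of_real[of "c *\<^sub>C x"] cinner_self_of_real[of x]
      complex_norm_square[of c]
    by (simp add: power2_norm_eq_inner[of x] power2_norm_eq_inner[of "c *\<^sub>C x"] power_mult_distrib
        cinner_scaleC_left cinner_scaleC_right mult_ac)
  then have "(norm (c *\<^sub>C x))\<^sup>2 = (cmod c * norm x)\<^sup>2"
    using of_real_eq_iff by blast
  then show ?thesis
    by (simp add: power2_eq_imp_eq)
qed

lemma scaleC_zero_right [simp]: "c *\<^sub>C 0 = (0 :: 'a::complex_hilbert_space)"
  using norm_scaleC[of c "0::'a"] by simp

lemma scaleC_scaleR: "c *\<^sub>C (r *\<^sub>R x) = r *\<^sub>R (c *\<^sub>C x)"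
  by (metis mult.commute scaleC_of_real scaleC_scaleC)

lemma tendsto_scaleC:
  fixes l :: "'a::complex_hilbert_space"
  assumes "(f \<longlongrightarrow> l) F"
  shows "((\<lambda>n. c *\<^sub>C f n) \<longlongrightarrow> c *\<^sub>C l) F"
proof -
  have "bounded_linear (\<lambda>x::'a. c *\<^sub>C x)"
    by (rule bounded_linear_intro[where K = "cmod c"])
      (auto simp: scaleC_add_right scaleC_scaleR norm_scaleC)
  then show ?thesis
    using assms by (rule bounded_linear.tendsto)
qed

lemma closed_csubspaceD:
  assumes "closed_csubspace M"
  shows "0 \<in> M" "x \<in> M \<Longrightarrow> y \<in> M \<Longrightarrow> x + y \<in> M" "x \<in> M \<Longrightarrow> y \<in> M \<Longrightarrow> x - y \<in> M"
    "x \<in> M \<Longrightarrow> - x \<in> M" "x \<in> M \<Longrightarrow> r *\<^sub>R x \<in> M" "x \<in> M \<Longrightarrow> c *\<^sub>C x \<in> M"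
    "closed M" "subspace M"
  using assms unfolding closed_csubspace_def
  by (auto intro: subspace_0 subspace_add subspace_diff subspace_neg subspace_mul)

lemma cinner_ext:
  assumes "closed_csubspace M" "x \<in> M" "y \<in> M" "\<And>m. m \<in> M \<Longrightarrow> cinner m x = cinner m y"
  shows "x = y"
proof -
  have "cinner (x - y) (x - y) = 0"
    using assms(4)[OF closed_csubspaceD(3)[OF assms(1-3)]] by (simp add: cinner_diff_right)
  then show ?thesis by simp
qed

subsection \<open>Riesz representation and adjoints\<close>

lemma quadratic_nonneg_imp_linear_zero:
  fixes a b :: real
  assumes "\<And>t. 0 \<le> 2 * t * a + t\<^sup>2 * b" "b \<ge> 0"
  shows "a = 0"
proof -
  have b: "b + 1 > 0" using assms(2) by simp
  \<comment> \<open>The quadratic is minimal at \<open>t = - a / b\<close>; replacing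
    \<open>b\<close> by \<open>b + 1\<close> keeps the value negative for nonzero \<open>a\<close>
    and avoids dividing by zero.\<close>
  have "2 * (- a / (b + 1)) * a + (- a / (b + 1))\<^sup>2 * b = - (a\<^sup>2 * (b + 2)) / (b + 1)\<^sup>2"
    using b by (simp add: divide_simps power2_eq_square) (simp add: algebra_simps)
  then have "a\<^sup>2 * (b + 2) / (b + 1)\<^sup>2 \<le> 0"
    using assms(1)[of "- a / (b + 1)"] by simp
  then have "a\<^sup>2 * (b + 2) \<le> 0"
    using b by (simp add: divide_le_0_iff)
  then show ?thesis
    using assms(2) by (simp add: mult_le_0_iff)
qed

text \<open>The representing vector minimises \<open>\<parallel>m\<parallel>\<^sup>2 - 2 f m\<close>; by the parallelogram law minimising
  sequences are Cauchy.\<close>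

lemma riesz_representation:
  fixes f :: "'a::{banach, real_inner} \<Rightarrow> real"
  assumes M: "subspace M" "closed M"
    and add: "\<And>x y. x \<in> M \<Longrightarrow> y \<in> M \<Longrightarrow> f (x + y) = f x + f y"
    and scale: "\<And>r x. x \<in> M \<Longrightarrow> f (r *\<^sub>R x) = r * f x"
    and bdd: "\<And>x. x \<in> M \<Longrightarrow> \<bar>f x\<bar> \<le> K * norm x"
  shows "\<exists>x\<in>M. \<forall>m\<in>M. f m = inner m x"
proof -
  define g where "g m = (norm m)\<^sup>2 - 2 * f m" for m
  define I where "I = Inf (g ` M)"
  have M0: "0 \<in> M" using M(1) by (rule subspace_0)
  have lower: "g m \<ge> - K\<^sup>2" if "m \<in> M" for m
  proof -
    have "0 \<le> (norm m - K)\<^sup>2" by simp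
    then show ?thesis
      using bdd[OF that] unfolding g_def power2_diff by (simp add: algebra_simps)
  qed
  have bb: "bdd_below (g ` M)" using lower by (auto intro!: bdd_belowI)
  have I_le: "I \<le> g m" if "m \<in> M" for m
    unfolding I_def using that bb by (auto intro: cInf_lower)
  have "\<exists>m\<in>M. g m < I + inverse (real (Suc n))" for n
  proof -
    have "\<exists>y\<in>g ` M. y < I + inverse (real (Suc n))"
      unfolding I_def by (rule cInf_lessD) (use M0 in auto)
    then show ?thesis by blast
  qed
  then obtain X where X: "\<And>n. X n \<in> M" "\<And>n. g (X n) < I + inverse (real (Suc n))"
    by metis
  have par: "(norm (m - n))\<^sup>2 \<le> 2 * g m + 2 * g n - 4 * I" if "m \<in> M" "n \<in> M" for m n
  proof -
    have mem: "(1/2) *\<^sub>R (m + n) \<in> M" using that M(1) by (simp add: subspace_add subspace_mul)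
    have "(norm (m - n))\<^sup>2 = 2 * g m + 2 * g n - 4 * g ((1/2) *\<^sub>R (m + n))"
      using that M(1) unfolding g_def
      by (subst scale) (auto simp: add subspace_add power2_norm_eq_inner inner_add_left
          inner_add_right inner_diff_left inner_diff_right inner_commute algebra_simps)
    then show ?thesis using I_le[OF mem] by simp
  qed
  have "Cauchy X"
  proof (rule metric_CauchyI)
    fix e :: real assume "e > 0"
    \<comment> \<open>Both values of \<open>g\<close> exceed \<open>I\<close> by less than a quarter
      of the square of \<open>e\<close>, so the bound \<open>2 * g m + 2 * g n - 4 * I\<close> from
      \<open>par\<close> stays below that square.\<close>
    then obtain N where N: "N > 0" "inverse (real N) < e\<^sup>2 / 4"
      using ex_inverse_of_nat_less[of "e\<^sup>2 / 4"] by auto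
    have "dist (X m) (X n) < e" if "m \<ge> N" "n \<ge> N" for m n
    proof -
      have i: "inverse (real (Suc k)) < e\<^sup>2 / 4" if "k \<ge> N" for k
        using N that by (smt (verit) le_imp_inverse_le of_nat_0_less_iff of_nat_le_iff le_SucI)
      have "(norm (X m - X n))\<^sup>2 < e\<^sup>2"
        using par[OF X(1) X(1), of m n] X(2)[of m] X(2)[of n] i[OF that(1)] i[OF that(2)] by linarith
      then show ?thesis
        using \<open>e > 0\<close> by (simp add: dist_norm power_less_imp_less_base)
    qed
    then show "\<exists>N. \<forall>m\<ge>N. \<forall>n\<ge>N. dist (X m) (X n) < e" by blast
  qed
  then obtain x where x: "X \<longlonglongrightarrow> x"
    using Cauchy_convergent convergent_def by blast
  have xM: "x \<in> M"
    using M(2) X(1) x closed_sequentially by blast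
  have diffM: "X n - x \<in> M" for n
    using X(1) xM M(1) by (simp add: subspace_diff)
  \<comment> \<open>\<open>f\<close> is linear and bounded only on \<open>M\<close>, so its
    continuity is argued through the differences \<open>X n - x\<close>, which lie in
    \<open>M\<close>.\<close>
  have f_split: "f (X n) = f (X n - x) + f x" for n
    using add[OF diffM xM, of n] by simp
  have lim0: "(\<lambda>n. f (X n - x)) \<longlonglongrightarrow> 0"
  proof (rule Lim_null_comparison)
    show "\<forall>\<^sub>F n in sequentially. norm (f (X n - x)) \<le> K * norm (X n - x)"
      using bdd[OF diffM] by simp
    show "(\<lambda>n. K * norm (X n - x)) \<longlonglongrightarrow> 0"
      using x by (intro tendsto_mult_right_zero tendsto_norm_zero) (simp add: LIM_zero)
  qed
  have limf: "(\<lambda>n. f (X n)) \<longlonglongrightarrow> f x"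
    using tendsto_add[OF lim0 tendsto_const[of "f x"]] by (simp flip: f_split)
  have limg: "(\<lambda>n. g (X n)) \<longlonglongrightarrow> g x"
    unfolding g_def by (intro tendsto_intros x limf)
  have "g x \<le> I + 0"
  proof (rule LIMSEQ_le[OF limg])
    show "(\<lambda>n. I + inverse (real (Suc n))) \<longlonglongrightarrow> I + 0"
      by (intro tendsto_intros LIMSEQ_inverse_real_of_nat)
    show "\<exists>N. \<forall>n\<ge>N. g (X n) \<le> I + inverse (real (Suc n))"
      using X(2) less_imp_le by blast
  qed
  then have min: "g x \<le> g m" if "m \<in> M" for m
    using I_le[OF that] by simp
  have "f m = inner m x" if m: "m \<in> M" for m
  proof -
    \<comment> \<open>Minimality of \<open>g\<close> at \<open>x\<close> along the line
      \<open>x + t *\<^sub>R m\<close>; the linear coefficient has to vanish.\<close>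
    have "0 \<le> 2 * t * (inner m x - f m) + t\<^sup>2 * (norm m)\<^sup>2" for t
    proof -
      have "g x \<le> g (x + t *\<^sub>R m)"
        using min m xM M(1) by (simp add: subspace_add subspace_mul)
      moreover have "f (x + t *\<^sub>R m) = f x + t * f m"
        using add scale m xM M(1) by (simp add: subspace_mul)
      ultimately show ?thesis
        unfolding g_def power2_norm_eq_inner
        by (simp add: inner_add_left inner_add_right inner_commute power2_eq_square algebra_simps)
    qed
    then have "inner m x - f m = 0"
      by (rule quadratic_nonneg_imp_linear_zero) simp
    then show ?thesis by simp
  qed
  with xM show ?thesis by blast
qed

section \<open>Bounded operators between closed subspaces and their adjoints\<close>

lemma bounded_opD:
  assumes A: "bounded_op M N A" and M: "closed_csubspace M"
  shows "x \<in> M \<Longrightarrow> A x \<in> N" "x \<in> M \<Longrightarrow> y \<in> M \<Longrightarrow> A (x + y) = A x + A y"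
    "x \<in> M \<Longrightarrow> A (c *\<^sub>C x) = c *\<^sub>C A x" "x \<in> M \<Longrightarrow> A (r *\<^sub>R x) = r *\<^sub>R A x"
    "x \<in> M \<Longrightarrow> A (- x) = - A x" "x \<in> M \<Longrightarrow> y \<in> M \<Longrightarrow> A (x - y) = A x - A y" "A 0 = 0"
proof -
  show 1: "x \<in> M \<Longrightarrow> A x \<in> N" "x \<in> M \<Longrightarrow> y \<in> M \<Longrightarrow> A (x + y) = A x + A y"
    "x \<in> M \<Longrightarrow> A (c *\<^sub>C x) = c *\<^sub>C A x" for x y c
    using A unfolding bounded_op_def by auto
  show 2: "x \<in> M \<Longrightarrow> A (r *\<^sub>R x) = r *\<^sub>R A x" for x r
    by (metis 1(3) scaleC_of_real)
  show 3: "x \<in> M \<Longrightarrow> A (- x) = - A x" for x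
    using 2[of x "-1"] by simp
  show "x \<in> M \<Longrightarrow> y \<in> M \<Longrightarrow> A (x - y) = A x - A y" for x y
    using 1(2)[of x "- y"] 3 closed_csubspaceD(4)[OF M] by simp
  show "A 0 = 0"
    using 2[OF closed_csubspaceD(1)[OF M], of 0] by simp
qed

lemma bounded_op_bound:
  assumes "bounded_op M N A"
  obtains K where "K > 0" "\<And>x. x \<in> M \<Longrightarrow> norm (A x) \<le> K * norm x"
proof -
  obtain K where "\<forall>x\<in>M. norm (A x) \<le> K * norm x"
    using assms unfolding bounded_op_def by auto
  then have "norm (A x) \<le> (\<bar>K\<bar> + 1) * norm x" if "x \<in> M" for x
    using that by (smt (verit) mult_right_mono norm_ge_zero)
  then show ?thesis by (intro that[of "\<bar>K\<bar> + 1"]) auto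
qed

lemma bounded_op_tendsto:
  assumes "bounded_op M N A" "closed_csubspace M" "\<And>n. f n \<in> M" "l \<in> M" "f \<longlonglongrightarrow> l"
  shows "(\<lambda>n. A (f n)) \<longlonglongrightarrow> A l"
proof -
  obtain K where K: "K > 0" "\<And>x. x \<in> M \<Longrightarrow> norm (A x) \<le> K * norm x"
    using bounded_op_bound[OF assms(1)] by blast
  have "(\<lambda>n. A (f n) - A l) \<longlonglongrightarrow> 0"
  proof (rule Lim_null_comparison)
    show "\<forall>\<^sub>F n in sequentially. norm (A (f n) - A l) \<le> K * norm (f n - l)"
      using K(2) assms by (simp add: bounded_opD(6)[OF assms(1,2), symmetric] closed_csubspaceD(3))
    show "(\<lambda>n. K * norm (f n - l)) \<longlonglongrightarrow> 0"
      using assms(5) by (intro tendsto_mult_right_zero tendsto_norm_zero) (simp add: LIM_zero)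
  qed
  then show ?thesis by (simp add: LIM_zero_iff)
qed

text \<open>Riesz is applied to the real functional \<open>inner (A m) y\<close>; the imaginary part
  follows because \<open>M\<close> is closed under multiplication by \<open>\<i>\<close>. The vector
  \<open>y\<close> ranges over the whole space, so the adjoint takes values in \<open>M\<close>
  everywhere.\<close>

lemma cadj_exists1:
  assumes A: "bounded_op M N A" and M: "closed_csubspace M"
  shows "\<exists>!x. x \<in> M \<and> (\<forall>m\<in>M. cinner (A m) y = cinner m x)"
proof -
  obtain K where K: "K > 0" "\<And>x. x \<in> M \<Longrightarrow> norm (A x) \<le> K * norm x"
    using bounded_op_bound[OF A] by blast
  have "\<exists>x\<in>M. \<forall>m\<in>M. inner (A m) y = inner m x"
  proof (rule riesz_representation)
    show "\<bar>inner (A x) y\<bar> \<le> (K * norm y) * norm x" if "x \<in> M" for x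
    proof -
      have "\<bar>inner (A x) y\<bar> \<le> norm (A x) * norm y" by (rule Cauchy_Schwarz_ineq2)
      also have "\<dots> \<le> (K * norm x) * norm y" using K(2)[OF that] by (rule mult_right_mono) simp
      finally show ?thesis by (simp add: mult_ac)
    qed
  qed (auto simp: bounded_opD[OF A M] inner_add_left closed_csubspaceD[OF M])
  then obtain x where x: "x \<in> M" "\<And>m. m \<in> M \<Longrightarrow> inner (A m) y = inner m x" by blast
  have "cinner (A m) y = cinner m x" if "m \<in> M" for m
    using x(2)[OF that] x(2)[OF closed_csubspaceD(6)[OF M that, of \<i>]] bounded_opD(3)[OF A M that, of \<i>]
    by (intro complex_eqI) (simp_all add: Re_cinner Im_cinner)
  with x(1) show ?thesis
    by (intro ex1I[of _ x]) (auto intro: cinner_ext[OF M])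
qed

lemma cadj_mem:
  assumes "bounded_op M N A" "closed_csubspace M"
  shows "cadj M A y \<in> M"
  using theI'[OF cadj_exists1[OF assms, of y]] unfolding cadj_def by blast

lemma cinner_cadj_right:
  assumes "bounded_op M N A" "closed_csubspace M" "m \<in> M"
  shows "cinner m (cadj M A y) = cinner (A m) y"
  using theI'[OF cadj_exists1[OF assms(1,2), of y]] assms(3) unfolding cadj_def by auto

lemma cinner_cadj_left:
  assumes "bounded_op M N A" "closed_csubspace M" "m \<in> M"
  shows "cinner (cadj M A y) m = cinner y (A m)"
  using cinner_cadj_right[OF assms, of y] by (metis cinner_commute)

lemma cadj_eqI:
  assumes "bounded_op M N A" "closed_csubspace M" "x \<in> M"
    "\<And>m. m \<in> M \<Longrightarrow> cinner (A m) y = cinner m x"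
  shows "cadj M A y = x"
  unfolding cadj_def using cadj_exists1[OF assms(1,2), of y] assms(3,4) by (intro the1_equality) auto

lemma bounded_op_cadj:
  assumes A: "bounded_op M N A" and M: "closed_csubspace M"
  shows "bounded_op N M (cadj M A)"
proof -
  obtain K where K: "K > 0" "\<And>x. x \<in> M \<Longrightarrow> norm (A x) \<le> K * norm x"
    using bounded_op_bound[OF A] by blast
  have "norm (cadj M A y) \<le> K * norm y" for y
  proof -
    let ?z = "cadj M A y"
    have z: "?z \<in> M" by (rule cadj_mem[OF A M])
    \<comment> \<open>Testing the defining identity of the adjoint at \<open>?z\<close> itself
      leaves a factor \<open>norm ?z\<close> on both sides to cancel.\<close>
    have "(norm ?z)\<^sup>2 = inner (A ?z) y"
      using arg_cong[OF cinner_cadj_right[OF A M z, of y], of Re]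
      by (simp add: Re_cinner power2_norm_eq_inner)
    also have "\<dots> \<le> norm (A ?z) * norm y" by (rule norm_cauchy_schwarz)
    also have "\<dots> \<le> (K * norm ?z) * norm y" using K(2)[OF z] by (rule mult_right_mono) simp
    finally have "norm ?z * norm ?z \<le> norm ?z * (K * norm y)"
      by (simp add: power2_eq_square mult_ac)
    then show ?thesis
      using K(1) by (cases "norm ?z = 0") (auto simp: mult_le_cancel_left)
  qed
  moreover have "cadj M A (x + y) = cadj M A x + cadj M A y" for x y
    by (rule cadj_eqI[OF A M])
      (auto simp: cadj_mem[OF A M] closed_csubspaceD[OF M] cinner_add_right cinner_cadj_right[OF A M])
  moreover have "cadj M A (c *\<^sub>C x) = c *\<^sub>C cadj M A x" for c x
    by (rule cadj_eqI[OF A M])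
      (auto simp: cadj_mem[OF A M] closed_csubspaceD[OF M] cinner_scaleC_right cinner_cadj_right[OF A M])
  ultimately show ?thesis
    unfolding bounded_op_def using cadj_mem[OF A M] by blast
qed

lemma cadj_cadj:
  assumes A: "bounded_op M N A" and M: "closed_csubspace M" and N: "closed_csubspace N"
    and x: "x \<in> M"
  shows "cadj N (cadj M A) x = A x"
  using bounded_opD(1)[OF A M x]
  by (intro cadj_eqI[OF bounded_op_cadj[OF A M] N]) (auto simp: cinner_cadj_left[OF A M x])

lemma bounded_op_compose:
  assumes "bounded_op M N A" "bounded_op N L B"
  shows "bounded_op M L (B \<circ> A)"
proof -
  obtain K where K: "K > 0" "\<And>x. x \<in> M \<Longrightarrow> norm (A x) \<le> K * norm x"
    using bounded_op_bound[OF assms(1)] by blast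
  obtain J where J: "J > 0" "\<And>x. x \<in> N \<Longrightarrow> norm (B x) \<le> J * norm x"
    using bounded_op_bound[OF assms(2)] by blast
  have "norm ((B \<circ> A) x) \<le> (J * K) * norm x" if "x \<in> M" for x
  proof -
    have "A x \<in> N" using assms(1) that unfolding bounded_op_def by blast
    then have "norm (B (A x)) \<le> J * norm (A x)" by (rule J(2))
    also have "\<dots> \<le> J * (K * norm x)" using K(2)[OF that] J(1) by simp
    finally show ?thesis by simp
  qed
  then show ?thesis
    using assms unfolding bounded_op_def by auto
qed

lemma bounded_op_combine:
  assumes A: "bounded_op M N A" and B: "bounded_op M N B" and N: "closed_csubspace N"
  shows "bounded_op M N (\<lambda>x. a *\<^sub>R A x + b *\<^sub>R B x)"
proof -
  obtain K where K: "K > 0" "\<And>x. x \<in> M \<Longrightarrow> norm (A x) \<le> K * norm x"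
    using bounded_op_bound[OF A] by blast
  obtain J where J: "J > 0" "\<And>x. x \<in> M \<Longrightarrow> norm (B x) \<le> J * norm x"
    using bounded_op_bound[OF B] by blast
  have "norm (a *\<^sub>R A x + b *\<^sub>R B x) \<le> (\<bar>a\<bar> * K + \<bar>b\<bar> * J) * norm x" if "x \<in> M" for x
  proof -
    have "norm (a *\<^sub>R A x + b *\<^sub>R B x) \<le> \<bar>a\<bar> * norm (A x) + \<bar>b\<bar> * norm (B x)"
      by (rule norm_triangle_le) simp
    also have "\<dots> \<le> \<bar>a\<bar> * (K * norm x) + \<bar>b\<bar> * (J * norm x)"
      using K(2)[OF that] J(2)[OF that] by (intro add_mono mult_left_mono) auto
    finally show ?thesis by (simp add: algebra_simps)
  qed
  moreover have "a *\<^sub>R A x + b *\<^sub>R B x \<in> N" if "x \<in> M" for x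
    using that A B unfolding bounded_op_def by (auto intro!: closed_csubspaceD[OF N])
  ultimately show ?thesis
    using A B unfolding bounded_op_def
    by (intro conjI exI[of _ "\<bar>a\<bar> * K + \<bar>b\<bar> * J"])
      (simp_all add: scaleR_add_right scaleC_add_right scaleC_scaleR)
qed

lemma bounded_op_id: "bounded_op M M (\<lambda>x. x)"
  unfolding bounded_op_def by (auto intro: exI[of _ 1])

lemma bounded_op_add:
  assumes "bounded_op M N A" "bounded_op M N B" "closed_csubspace N"
  shows "bounded_op M N (\<lambda>x. A x + B x)"
  using bounded_op_combine[OF assms, of 1 1] by simp

lemma bounded_op_diff:
  assumes "bounded_op M N A" "bounded_op M N B" "closed_csubspace N"
  shows "bounded_op M N (\<lambda>x. A x - B x)"
  using bounded_op_combine[OF assms, of 1 "-1"] by simp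

subsection \<open>Positive operators and their square roots\<close>

text \<open>Polarisation: the form being real at x + y compares the imaginary parts of
  \<open>cinner (A x) y\<close> and \<open>cinner (A y) x\<close>, and its being real at x + i y
  compares their real parts.\<close>

lemma positive_op_selfadjoint:
  assumes A: "positive_op M A" and M: "closed_csubspace M" and x: "x \<in> M" and y: "y \<in> M"
  shows "cinner (A x) y = cinner x (A y)"
proof -
  have bA: "bounded_op M M A" using A unfolding positive_op_def by blast
  note mem = closed_csubspaceD[OF M] and lin = bounded_opD[OF bA M]
  have Im0: "Im (cinner (A z) z) = 0" if "z \<in> M" for z
    using A that unfolding positive_op_def by (auto simp: complex_nonneg_Reals_iff)
  have pol: "Im (cinner (A x) z) + Im (cinner (A z) x) = 0" if "z \<in> M" for z
    using Im0[OF mem(2)[OF x that]] Im0[OF x] Im0[OF that] x that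
    by (simp add: lin cinner_add_left cinner_add_right)
  have "Im (cinner (A x) y) = - Im (cinner (A y) x)"
    using pol[OF y] by simp
  moreover have "Re (cinner (A x) y) = Re (cinner (A y) x)"
    using pol[OF mem(6)[OF y, of \<i>]] y by (simp add: lin cinner_scaleC_left cinner_scaleC_right)
  moreover have "cinner x (A y) = cnj (cinner (A y) x)" by (rule cinner_commute)
  ultimately show ?thesis by (simp add: complex_eq_iff)
qed

text \<open>This is A^2 <= K A. Positivity at \<open>z = K *\<^sub>R x - A x\<close> gives it once
  the term \<open>inner (A (A x)) (A x)\<close> is bounded by \<open>K * inner (A x) (A x)\<close>.
  It serves to show that I - A/K is a contraction and that a vanishing form forces
  \<open>A x = 0\<close>.\<close>

lemma positive_op_norm_le:
  assumes A: "positive_op M A" and M: "closed_csubspace M" and x: "x \<in> M"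
    and K: "K > 0" "\<And>x. x \<in> M \<Longrightarrow> norm (A x) \<le> K * norm x"
  shows "(norm (A x))\<^sup>2 \<le> K * inner (A x) x"
proof -
  have bA: "bounded_op M M A" using A unfolding positive_op_def by blast
  note mem = closed_csubspaceD[OF M] and lin = bounded_opD[OF bA M]
  have pos: "inner (A z) z \<ge> 0" if "z \<in> M" for z
    using A that unfolding positive_op_def by (auto simp: complex_nonneg_Reals_iff Re_cinner)
  have sa: "inner (A u) v = inner u (A v)" if "u \<in> M" "v \<in> M" for u v
    using arg_cong[OF positive_op_selfadjoint[OF A M that], of Re] by (simp add: Re_cinner)
  define z where "z = K *\<^sub>R x - A x"
  have Ax: "A x \<in> M" and z: "z \<in> M" unfolding z_def using x by (auto simp: mem lin)
  have "inner (A (A x)) (A x) \<le> norm (A (A x)) * norm (A x)" by (rule norm_cauchy_schwarz)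
  also have "\<dots> \<le> K * norm (A x) * norm (A x)"
    using K(2)[OF Ax] by (rule mult_right_mono) simp
  finally have 1: "inner (A (A x)) (A x) \<le> K * inner (A x) (A x)"
    by (simp add: power2_norm_eq_inner[symmetric] power2_eq_square mult_ac)
  have "0 \<le> inner (A z) z" by (rule pos[OF z])
  also have "inner (A z) z = K * (K * inner (A x) x) - 2 * (K * inner (A x) (A x)) + inner (A (A x)) (A x)"
    unfolding z_def using x Ax sa[OF Ax x]
    by (simp add: lin mem inner_diff_left inner_diff_right inner_commute algebra_simps)
  finally have "0 \<le> K * (K * inner (A x) x - inner (A x) (A x))"
    using 1 by (simp add: algebra_simps)
  then show ?thesis
    using K(1) by (simp add: zero_le_mult_iff power2_norm_eq_inner)
qed

text \<open>Fixed-point iteration for Y = (B + Y^2)/2, which is equivalent to (I - Y)^2 = I - B. For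
  linear \<open>B\<close> each iterate is a polynomial in \<open>B\<close>, so commutation with and
  selfadjointness of \<open>B\<close> pass to it.\<close>

primrec half_square_iter :: "('a::real_vector \<Rightarrow> 'a) \<Rightarrow> nat \<Rightarrow> 'a \<Rightarrow> 'a" where
  "half_square_iter B 0 = (\<lambda>x. 0)"
| "half_square_iter B (Suc n) =
    (\<lambda>x. (1/2) *\<^sub>R (B x + half_square_iter B n (half_square_iter B n x)))"

text \<open>The scalar iteration majorises the increments of the operator iteration for a contraction.\<close>

primrec half_square_majorant :: "nat \<Rightarrow> real" where
  "half_square_majorant 0 = 0"
| "half_square_majorant (Suc n) = (1 + (half_square_majorant n)\<^sup>2) / 2"

lemma half_square_majorant_bounds: "0 \<le> half_square_majorant n" "half_square_majorant n \<le> 1"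
proof (induction n)
  case (Suc n)
  { case 1 show ?case by simp }
  { case 2 show ?case using Suc power_le_one[of "half_square_majorant n" 2] by simp }
qed auto

lemma half_square_majorant_mono: "mono half_square_majorant"
proof (rule incseq_SucI)
  fix n
  have "0 \<le> (1 - half_square_majorant n)\<^sup>2" by simp
  then show "half_square_majorant n \<le> half_square_majorant (Suc n)"
    by (simp add: power2_diff)
qed

lemma Cauchy_half_square_majorant: "Cauchy half_square_majorant"
proof -
  have "convergent half_square_majorant"
    using half_square_majorant_bounds half_square_majorant_mono
    by (intro Bseq_mono_convergent BseqI'[where K = 1]) (auto simp: mono_def)
  then show ?thesis by (rule convergent_Cauchy)
qed

context
  fixes M :: "'a::complex_hilbert_space set" and B :: "'a \<Rightarrow> 'a"
  assumes M: "closed_csubspace M" and B: "bounded_op M M B"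
    and contr: "\<And>x. x \<in> M \<Longrightarrow> norm (B x) \<le> norm x"
begin

lemma bounded_op_half_square_iter: "bounded_op M M (half_square_iter B n)"
proof (induction n)
  case 0
  show ?case
    by (auto simp: bounded_op_def closed_csubspaceD[OF M] intro: exI[of _ 0])
next
  case (Suc n)
  show ?case
    using bounded_op_combine[OF B bounded_op_compose[OF Suc Suc] M, of "1/2" "1/2"]
    by (simp add: scaleR_add_right)
qed

lemma half_square_iter_commute:
  assumes C: "bounded_op M M C" "\<And>x. x \<in> M \<Longrightarrow> C (B x) = B (C x)" and "x \<in> M"
  shows "C (half_square_iter B n x) = half_square_iter B n (C x)"
  using assms(3)
proof (induction n arbitrary: x)
  case (Suc n)
  note Y = bounded_opD(1)[OF bounded_op_half_square_iter M]
  show ?case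
    using Suc C(2) by (simp add: bounded_opD[OF C(1) M] bounded_opD[OF B M] Y closed_csubspaceD[OF M])
qed (simp add: bounded_opD[OF C(1) M])

lemma half_square_iter_selfadjoint:
  assumes "\<And>x y. x \<in> M \<Longrightarrow> y \<in> M \<Longrightarrow> inner (B x) y = inner x (B y)" "x \<in> M" "y \<in> M"
  shows "inner (half_square_iter B n x) y = inner x (half_square_iter B n y)"
  using assms(2,3)
proof (induction n arbitrary: x y)
  case (Suc n)
  then show ?case
    by (simp add: inner_add_left inner_add_right assms(1) bounded_opD(1)[OF bounded_op_half_square_iter M])
qed simp

lemma half_square_iter_norm:
  "x \<in> M \<Longrightarrow> norm (half_square_iter B n x) \<le> half_square_majorant n * norm x"
proof (induction n arbitrary: x)
  case (Suc n)
  let ?Y = "half_square_iter B n" and ?b = "half_square_majorant n"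
  have Y: "?Y x \<in> M" by (rule bounded_opD(1)[OF bounded_op_half_square_iter M Suc.prems])
  have "norm (?Y (?Y x)) \<le> ?b * norm (?Y x)" by (rule Suc.IH[OF Y])
  also have "\<dots> \<le> ?b * (?b * norm x)"
    using Suc.IH[OF Suc.prems] half_square_majorant_bounds(1) by (rule mult_left_mono)
  finally have "norm (B x + ?Y (?Y x)) \<le> norm x + ?b * (?b * norm x)"
    using contr[OF Suc.prems] by (intro norm_triangle_le) simp
  then show ?case by (simp add: power2_eq_square distrib_left mult_ac)
qed simp

text \<open>The splitting Z^2 - Y^2 = Z (Z - Y) + (Z - Y) Y requires no commutation and bounds the
  two terms by b (b - a) and (b - a) a. Their sum b^2 - a^2 is twice the next increment of the
  majorant.\<close>

lemma half_square_iter_step: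
  "x \<in> M \<Longrightarrow> norm (half_square_iter B (Suc n) x - half_square_iter B n x)
    \<le> (half_square_majorant (Suc n) - half_square_majorant n) * norm x"
proof (induction n arbitrary: x)
  case 0
  then show ?case using contr by simp
next
  case (Suc n)
  define Y Z a b where "Y = half_square_iter B n" and "Z = half_square_iter B (Suc n)"
    and "a = half_square_majorant n" and "b = half_square_majorant (Suc n)"
  note x = Suc.prems
  have bY: "bounded_op M M Y" and bZ: "bounded_op M M Z"
    unfolding Y_def Z_def by (rule bounded_op_half_square_iter)+
  have Yx: "Y x \<in> M" and Zx: "Z x \<in> M" using bounded_opD(1)[OF bY M x] bounded_opD(1)[OF bZ M x] by auto
  have ab: "0 \<le> a" "0 \<le> b" "a \<le> b" and IH: "\<And>x. x \<in> M \<Longrightarrow> norm (Z x - Y x) \<le> (b - a) * norm x"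
    unfolding a_def b_def Y_def Z_def
    using half_square_majorant_bounds(1) half_square_majorant_mono[THEN monoD, of n "Suc n"] Suc.IH by auto
  have "norm (Z (Z x - Y x)) \<le> b * norm (Z x - Y x)"
    unfolding b_def Z_def
    by (rule half_square_iter_norm) (use Yx Zx in \<open>auto simp: closed_csubspaceD[OF M] Z_def\<close>)
  also have "\<dots> \<le> b * ((b - a) * norm x)" using IH[OF x] ab(2) by (rule mult_left_mono)
  finally have 1: "norm (Z (Z x) - Z (Y x)) \<le> b * ((b - a) * norm x)"
    by (simp add: bounded_opD(6)[OF bZ M Zx Yx])
  have "norm (Y x) \<le> a * norm x" unfolding Y_def a_def by (rule half_square_iter_norm[OF x])
  then have "(b - a) * norm (Y x) \<le> (b - a) * (a * norm x)"
    using ab(3) by (intro mult_left_mono) auto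
  with IH[OF Yx] have 2: "norm (Z (Y x) - Y (Y x)) \<le> (b - a) * (a * norm x)" by linarith
  have "norm (Z (Z x) - Y (Y x)) \<le> b * ((b - a) * norm x) + (b - a) * (a * norm x)"
    using norm_triangle_le[OF add_mono[OF 1 2]] by simp
  also have "\<dots> = (b\<^sup>2 - a\<^sup>2) * norm x"
    by (simp add: algebra_simps power2_eq_square)
  finally have "norm (Z (Z x) - Y (Y x)) \<le> (b\<^sup>2 - a\<^sup>2) * norm x" .
  moreover have iter: "half_square_iter B (Suc (Suc n)) x - half_square_iter B (Suc n) x
      = (1/2) *\<^sub>R (Z (Z x) - Y (Y x))"
    by (simp add: Y_def Z_def algebra_simps)
  moreover have maj: "half_square_majorant (Suc (Suc n)) - half_square_majorant (Suc n) = (b\<^sup>2 - a\<^sup>2) / 2"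
    by (simp only: a_def b_def half_square_majorant.simps(2) add_divide_distrib diff_divide_distrib)
  ultimately show ?case unfolding iter maj by simp
qed

lemma half_square_iter_diff:
  assumes x: "x \<in> M" and "m \<le> n"
  shows "norm (half_square_iter B n x - half_square_iter B m x)
    \<le> (half_square_majorant n - half_square_majorant m) * norm x"
  using assms(2)
proof (induction n rule: dec_induct)
  case (step n)
  have "norm (half_square_iter B (Suc n) x - half_square_iter B m x)
      \<le> norm (half_square_iter B (Suc n) x - half_square_iter B n x)
        + norm (half_square_iter B n x - half_square_iter B m x)"
    using norm_triangle_ineq[of "half_square_iter B (Suc n) x - half_square_iter B n x"
        "half_square_iter B n x - half_square_iter B m x"] by simp
  then show ?case
    using step.IH half_square_iter_step[OF x, of n] by (simp only: left_diff_distrib)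
qed simp

lemma convergent_half_square_iter:
  assumes x: "x \<in> M"
  shows "convergent (\<lambda>n. half_square_iter B n x)"
proof -
  let ?Y = "\<lambda>n. half_square_iter B n x" and ?b = half_square_majorant
  have le: "norm (?Y m - ?Y n) \<le> norm (?b m - ?b n) * norm x" for m n
  proof (induction m n rule: linorder_wlog)
    case (le m n)
    then show ?case
      using half_square_iter_diff[OF x le] monoD[OF half_square_majorant_mono le]
      by (simp add: norm_minus_commute)
  qed (simp add: norm_minus_commute abs_minus_commute)
  have "Cauchy ?Y"
  proof (rule CauchyI)
    fix e :: real assume e: "e > 0"
    \<comment> \<open>The summand 1 keeps the denominator positive when
      \<open>x = 0\<close>.\<close>
    have "e / (norm x + 1) > 0" using e by (simp add: add_nonneg_pos)
    then obtain N where N: "\<And>m n. m \<ge> N \<Longrightarrow> n \<ge> N \<Longrightarrow> norm (?b m - ?b n) < e / (norm x + 1)"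
      using Cauchy_half_square_majorant CauchyD by metis
    have "norm (?Y m - ?Y n) < e" if "m \<ge> N" "n \<ge> N" for m n
    proof -
      have "norm (?Y m - ?Y n) \<le> norm (?b m - ?b n) * (norm x + 1)"
        using le[of m n] by (smt (verit) mult_left_mono norm_ge_zero)
      also have "\<dots> < e"
        using N[OF that] by (simp add: pos_less_divide_eq add_nonneg_pos)
      finally show ?thesis .
    qed
    then show "\<exists>N. \<forall>m\<ge>N. \<forall>n\<ge>N. norm (?Y m - ?Y n) < e" by blast
  qed
  then show ?thesis by (rule Cauchy_convergent)
qed

text \<open>The pointwise limit of the iterates inherits contractivity, commutation and
  selfadjointness; afterwards only these properties of \<open>Y\<close> matter.\<close>

lemma half_square_fixpoint:
  obtains Y where "bounded_op M M Y" "\<And>x. x \<in> M \<Longrightarrow> norm (Y x) \<le> norm x"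
    "\<And>x. x \<in> M \<Longrightarrow> Y x = (1/2) *\<^sub>R (B x + Y (Y x))"
    "\<And>C x. bounded_op M M C \<Longrightarrow> (\<And>x. x \<in> M \<Longrightarrow> C (B x) = B (C x)) \<Longrightarrow> x \<in> M \<Longrightarrow> C (Y x) = Y (C x)"
    "\<And>x y. (\<And>x y. x \<in> M \<Longrightarrow> y \<in> M \<Longrightarrow> inner (B x) y = inner x (B y)) \<Longrightarrow> x \<in> M \<Longrightarrow> y \<in> M \<Longrightarrow>
      inner (Y x) y = inner x (Y y)"
proof -
  let ?Y = "half_square_iter B"
  define Y where "Y x = lim (\<lambda>n. ?Y n x)" for x
  note bY = bounded_op_half_square_iter and mem = closed_csubspaceD[OF M]
  note linY = bounded_opD[OF bY M]
  have lim: "(\<lambda>n. ?Y n x) \<longlonglongrightarrow> Y x" if "x \<in> M" for x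
    using convergent_half_square_iter[OF that] unfolding Y_def by (simp add: convergent_LIMSEQ_iff)
  have YM: "Y x \<in> M" if "x \<in> M" for x
    by (rule closed_sequentially[OF mem(7) _ lim[OF that]]) (rule linY(1)[OF that])
  have nY': "norm (?Y n x) \<le> norm x" if "x \<in> M" for n x
    using half_square_iter_norm[OF that, of n] half_square_majorant_bounds(2)[of n]
      mult_right_mono[of "half_square_majorant n" 1 "norm x"] by simp
  have nY: "norm (Y x) \<le> norm x" if "x \<in> M" for x
    using tendsto_norm[OF lim[OF that]] nY'[OF that] by (intro LIMSEQ_le_const2) auto
  have addY: "Y (x + y) = Y x + Y y" if "x \<in> M" "y \<in> M" for x y
    using tendsto_add[OF lim[OF that(1)] lim[OF that(2)]]
    by (intro LIMSEQ_unique[OF lim[OF mem(2)[OF that]]]) (simp add: linY(2)[OF that])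
  have scY: "Y (c *\<^sub>C x) = c *\<^sub>C Y x" if "x \<in> M" for c x
    using tendsto_scaleC[OF lim[OF that], of c]
    by (intro LIMSEQ_unique[OF lim[OF mem(6)[OF that]]]) (simp add: linY(3)[OF that])
  have bdY: "bounded_op M M Y"
    unfolding bounded_op_def using YM addY scY nY by (intro conjI exI[of _ 1]) auto
  have fixed: "Y x = (1/2) *\<^sub>R (B x + Y (Y x))" if x: "x \<in> M" for x
  proof -
    \<comment> \<open>Convergence is only pointwise, so the square is handled as Y_n (Y_n x - Y x) +
      Y_n (Y x); the first term tends to 0 because all iterates are contractions.\<close>
    have "(\<lambda>n. ?Y n (?Y n x - Y x)) \<longlonglongrightarrow> 0"
    proof (rule Lim_null_comparison)
      show "\<forall>\<^sub>F n in sequentially. norm (?Y n (?Y n x - Y x)) \<le> norm (?Y n x - Y x)"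
        using nY' linY(1)[OF x] YM[OF x] by (simp add: mem)
      show "(\<lambda>n. norm (?Y n x - Y x)) \<longlonglongrightarrow> 0"
        using lim[OF x] by (simp add: tendsto_norm_zero LIM_zero)
    qed
    from tendsto_add[OF this lim[OF YM[OF x]]]
    have "(\<lambda>n. ?Y n (?Y n x)) \<longlonglongrightarrow> Y (Y x)"
      by (simp add: linY(6)[OF linY(1)[OF x] YM[OF x]])
    then have "(\<lambda>n. ?Y (Suc n) x) \<longlonglongrightarrow> (1/2) *\<^sub>R (B x + Y (Y x))"
      unfolding half_square_iter.simps by (intro tendsto_intros)
    then show ?thesis
      by (rule LIMSEQ_unique[OF LIMSEQ_Suc[OF lim[OF x]]])
  qed
  have comm: "C (Y x) = Y (C x)"
    if C: "bounded_op M M C" "\<And>x. x \<in> M \<Longrightarrow> C (B x) = B (C x)" and x: "x \<in> M" for C x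
    using bounded_op_tendsto[OF C(1) M linY(1)[OF x] YM[OF x] lim[OF x]]
    by (intro LIMSEQ_unique[OF _ lim[OF bounded_opD(1)[OF C(1) M x]]])
      (simp add: half_square_iter_commute[OF C x])
  have sa: "inner (Y x) y = inner x (Y y)"
    if "\<And>x y. x \<in> M \<Longrightarrow> y \<in> M \<Longrightarrow> inner (B x) y = inner x (B y)" "x \<in> M" "y \<in> M" for x y
    using tendsto_inner[OF tendsto_const[of x] lim[OF that(3)]]
    by (intro LIMSEQ_unique[OF tendsto_inner[OF lim[OF that(2)] tendsto_const[of y]]])
      (simp add: half_square_iter_selfadjoint[OF that])
  show ?thesis using that bdY nY fixed comm sa by blast
qed

end

section \<open>Square roots and moduli\<close>

lemma positive_opI:
  assumes A: "bounded_op M M A" and M: "closed_csubspace M"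
    and sa: "\<And>x y. x \<in> M \<Longrightarrow> y \<in> M \<Longrightarrow> inner (A x) y = inner x (A y)"
    and pos: "\<And>x. x \<in> M \<Longrightarrow> 0 \<le> inner (A x) x"
  shows "positive_op M A"
proof -
  \<comment> \<open>Real symmetry at \<open>\<i> *\<^sub>C x\<close> and \<open>x\<close> makes this
    imaginary part unchanged under exchanging the arguments, while conjugate symmetry changes its
    sign.\<close>
  have "Im (cinner (A x) x) = 0" if x: "x \<in> M" for x
  proof -
    have "Im (cinner x (A x)) = Im (cinner (A x) x)"
      using sa[OF closed_csubspaceD(6)[OF M x, of \<i>] x] by (simp add: Im_cinner bounded_opD(3)[OF A M x])
    moreover have "Im (cinner (A x) x) = - Im (cinner x (A x))"
      by (subst cinner_commute) simp
    ultimately show ?thesis by simp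
  qed
  then show ?thesis
    using A pos unfolding positive_op_def by (auto simp: complex_nonneg_Reals_iff Re_cinner)
qed

lemma positive_opD:
  assumes A: "positive_op M A" and M: "closed_csubspace M"
  shows "bounded_op M M A" "x \<in> M \<Longrightarrow> 0 \<le> inner (A x) x"
    "x \<in> M \<Longrightarrow> y \<in> M \<Longrightarrow> inner (A x) y = inner x (A y)"
  using A arg_cong[OF positive_op_selfadjoint[OF A M, of x y], of Re]
  unfolding positive_op_def by (auto simp: complex_nonneg_Reals_iff Re_cinner)

text \<open>With \<open>B = I - A / K\<close> and \<open>Y = (B + Y\<^sup>2) / 2\<close>, the operator \<open>I - Y\<close> squares to \<open>A / K\<close>.\<close>

lemma positive_op_sqrt_exists:
  assumes A: "positive_op M A" and M: "closed_csubspace M"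
  obtains S where "positive_op M S" "\<And>x. x \<in> M \<Longrightarrow> S (S x) = A x" "\<And>x. x \<notin> M \<Longrightarrow> S x = 0"
    "\<And>C x. bounded_op M M C \<Longrightarrow> (\<And>x. x \<in> M \<Longrightarrow> C (A x) = A (C x)) \<Longrightarrow> x \<in> M \<Longrightarrow> C (S x) = S (C x)"
proof -
  note mem = closed_csubspaceD[OF M] and bA = positive_opD(1)[OF A M]
  note lin = bounded_opD[OF bA M]
  obtain K where K: "K > 0" "\<And>x. x \<in> M \<Longrightarrow> norm (A x) \<le> K * norm x"
    using bounded_op_bound[OF bA] by blast
  define B where "B x = x - (1/K) *\<^sub>R A x" for x
  have bB: "bounded_op M M B"
    using bounded_op_combine[OF bounded_op_id bA M, of 1 "- (1/K)"] unfolding B_def by simp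
  have contr: "norm (B x) \<le> norm x" if x: "x \<in> M" for x
  proof -
    \<comment> \<open>By \<open>positive_op_norm_le\<close> the last term is at most
      \<open>inner (A x) x / K\<close>, so half of the middle term absorbs it.\<close>
    have "(norm (B x))\<^sup>2 = (norm x)\<^sup>2 - 2 / K * inner (A x) x + (norm (A x))\<^sup>2 / K\<^sup>2"
      unfolding B_def power2_norm_eq_inner
      by (simp add: inner_diff_left inner_diff_right inner_commute power2_eq_square)
    also have "(norm (A x))\<^sup>2 / K\<^sup>2 \<le> K * inner (A x) x / K\<^sup>2"
      using positive_op_norm_le[OF A M x K] by (simp add: divide_right_mono)
    also have "K * inner (A x) x / K\<^sup>2 = inner (A x) x / K"
      using K(1) by (simp add: power2_eq_square)
    finally have "(norm (B x))\<^sup>2 \<le> (norm x)\<^sup>2 - inner (A x) x / K" by simp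
    moreover have "0 \<le> inner (A x) x / K" using positive_opD(2)[OF A M x] K(1) by simp
    ultimately have "(norm (B x))\<^sup>2 \<le> (norm x)\<^sup>2" by linarith
    then show ?thesis by (rule power2_le_imp_le) simp
  qed
  have saB: "inner (B x) y = inner x (B y)" if "x \<in> M" "y \<in> M" for x y
    unfolding B_def using positive_opD(3)[OF A M that] by (simp add: inner_diff_left inner_diff_right)
  obtain Y where Y: "bounded_op M M Y" "\<And>x. x \<in> M \<Longrightarrow> norm (Y x) \<le> norm x"
    "\<And>x. x \<in> M \<Longrightarrow> Y x = (1/2) *\<^sub>R (B x + Y (Y x))"
    "\<And>C x. bounded_op M M C \<Longrightarrow> (\<And>x. x \<in> M \<Longrightarrow> C (B x) = B (C x)) \<Longrightarrow> x \<in> M \<Longrightarrow> C (Y x) = Y (C x)"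
    "\<And>x y. (\<And>x y. x \<in> M \<Longrightarrow> y \<in> M \<Longrightarrow> inner (B x) y = inner x (B y)) \<Longrightarrow> x \<in> M \<Longrightarrow> y \<in> M \<Longrightarrow>
      inner (Y x) y = inner x (Y y)"
    using half_square_fixpoint[OF M bB contr] by blast
  note linY = bounded_opD[OF Y(1) M]
  \<comment> \<open>The factor \<open>sqrt K\<close> undoes the scaling of \<open>A\<close> by
    \<open>1/K\<close>; the value 0 off \<open>M\<close> is the normalisation in
    \<open>op_sqrt\<close>.\<close>
  define S where "S x = (if x \<in> M then sqrt K *\<^sub>R (x - Y x) else 0)" for x
  have SM: "S x \<in> M" if "x \<in> M" for x
    using that unfolding S_def by (auto simp: mem linY)
  have "bounded_op M M (\<lambda>x. sqrt K *\<^sub>R x + (- sqrt K) *\<^sub>R Y x)"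
    by (rule bounded_op_combine[OF bounded_op_id Y(1) M])
  then have bS: "bounded_op M M S"
    unfolding bounded_op_def S_def by (auto simp: mem scaleR_diff_right)
  have "positive_op M S"
  proof (rule positive_opI[OF bS M])
    show "inner (S x) y = inner x (S y)" if "x \<in> M" "y \<in> M" for x y
      using Y(5)[OF saB that] that unfolding S_def by (simp add: inner_diff_left inner_diff_right)
    show "0 \<le> inner (S x) x" if "x \<in> M" for x
    proof -
      have "inner (Y x) x \<le> norm (Y x) * norm x" by (rule norm_cauchy_schwarz)
      also have "\<dots> \<le> norm x * norm x" using Y(2)[OF that] by (rule mult_right_mono) simp
      finally show ?thesis
        using K(1) that unfolding S_def
        by (simp add: inner_diff_left power2_norm_eq_inner[symmetric] power2_eq_square)
    qed
  qed
  moreover have "S (S x) = A x" if x: "x \<in> M" for x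
  proof -
    have "S (S x) = K *\<^sub>R (x - 2 *\<^sub>R Y x + Y (Y x))"
      using SM[OF x] K(1) x unfolding S_def
      by (simp add: linY mem scaleR_diff_right algebra_simps flip: scaleR_2)
    also have "2 *\<^sub>R Y x = B x + Y (Y x)" by (subst Y(3)[OF x]) simp
    finally show ?thesis using K(1) by (simp add: B_def)
  qed
  moreover have "S x = 0" if "x \<notin> M" for x using that by (simp add: S_def)
  moreover have "C (S x) = S (C x)"
    if C: "bounded_op M M C" "\<And>x. x \<in> M \<Longrightarrow> C (A x) = A (C x)" and x: "x \<in> M" for C x
  proof -
    note linC = bounded_opD[OF C(1) M]
    have "C (B u) = B (C u)" if "u \<in> M" for u
      unfolding B_def using that C(2)[OF that] by (simp add: linC mem lin)
    then have "C (Y x) = Y (C x)" using Y(4)[OF C(1) _ x] by blast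
    then show ?thesis using x unfolding S_def by (simp add: linC linY mem)
  qed
  ultimately show ?thesis using that by blast
qed

lemma positive_op_form_zero:
  assumes A: "positive_op M A" and M: "closed_csubspace M" and x: "x \<in> M" and 0: "inner (A x) x = 0"
  shows "A x = 0"
proof -
  obtain K where K: "K > 0" "\<And>x. x \<in> M \<Longrightarrow> norm (A x) \<le> K * norm x"
    using bounded_op_bound[OF positive_opD(1)[OF A M]] by blast
  then show ?thesis using positive_op_norm_le[OF A M x K] 0 by simp
qed

text \<open>For y = (S - R) x, commutation and equal squares give (S + R) y = 0. The two nonnegative
  forms \<open>inner (S y) y\<close> and \<open>inner (R y) y\<close> then add up to zero, so
  \<open>S y = 0\<close> and \<open>R y = 0\<close>, and moving \<open>S\<close> and
  \<open>R\<close> across the inner product yields \<open>inner y y = 0\<close>.\<close>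

lemma positive_op_sqrt_unique:
  assumes R: "positive_op M R" and S: "positive_op M S" and M: "closed_csubspace M"
    and sq: "\<And>x. x \<in> M \<Longrightarrow> R (R x) = S (S x)"
    and comm: "\<And>x. x \<in> M \<Longrightarrow> R (S x) = S (R x)" and x: "x \<in> M"
  shows "R x = S x"
proof -
  note mem = closed_csubspaceD[OF M]
  note linR = bounded_opD[OF positive_opD(1)[OF R M] M] and linS = bounded_opD[OF positive_opD(1)[OF S M] M]
  define y where "y = S x - R x"
  have y: "y \<in> M" unfolding y_def using x by (simp add: mem linR linS)
  have "S y + R y = 0"
    unfolding y_def using x sq[OF x] comm[OF x] by (simp add: linR linS)
  then have "inner (S y) y + inner (R y) y = 0" by (simp flip: inner_add_left)
  then have "inner (S y) y = 0" "inner (R y) y = 0"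
    using positive_opD(2)[OF S M y] positive_opD(2)[OF R M y] by linarith+
  then have "S y = 0" "R y = 0"
    using positive_op_form_zero[OF S M y] positive_op_form_zero[OF R M y] by auto
  then have "inner (S x) y = 0" "inner (R x) y = 0"
    using positive_opD(3)[OF S M x y] positive_opD(3)[OF R M x y] by auto
  then have "inner y y = 0" unfolding y_def by (simp add: inner_diff_left)
  then show ?thesis unfolding y_def by simp
qed

text \<open>Any competing root \<open>R\<close> commutes with its own square, which is
  \<open>A\<close>. The constructed root commutes with everything that commutes with
  \<open>A\<close>, hence with \<open>R\<close>, and this supplies the commutation that
  \<open>positive_op_sqrt_unique\<close> demands.\<close>

lemma op_sqrt:
  assumes A: "positive_op M A" and M: "closed_csubspace M"
  shows positive_op_sqrt: "positive_op M (op_sqrt M A)"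
    and op_sqrt_op_sqrt: "x \<in> M \<Longrightarrow> op_sqrt M A (op_sqrt M A x) = A x"
    and op_sqrt_commute: "bounded_op M M C \<Longrightarrow> (\<And>x. x \<in> M \<Longrightarrow> C (A x) = A (C x)) \<Longrightarrow> x \<in> M \<Longrightarrow>
      C (op_sqrt M A x) = op_sqrt M A (C x)"
proof -
  obtain S where S: "positive_op M S" "\<And>x. x \<in> M \<Longrightarrow> S (S x) = A x" "\<And>x. x \<notin> M \<Longrightarrow> S x = 0"
    "\<And>C x. bounded_op M M C \<Longrightarrow> (\<And>x. x \<in> M \<Longrightarrow> C (A x) = A (C x)) \<Longrightarrow> x \<in> M \<Longrightarrow> C (S x) = S (C x)"
    using positive_op_sqrt_exists[OF A M] by blast
  have "op_sqrt M A = S"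
    unfolding op_sqrt_def
  proof (rule the_equality)
    show "positive_op M S \<and> (\<forall>x\<in>M. S (S x) = A x) \<and> (\<forall>x. x \<notin> M \<longrightarrow> S x = 0)"
      using S by blast
    fix R assume "positive_op M R \<and> (\<forall>x\<in>M. R (R x) = A x) \<and> (\<forall>x. x \<notin> M \<longrightarrow> R x = 0)"
    then have R: "positive_op M R" "\<And>x. x \<in> M \<Longrightarrow> R (R x) = A x" "\<And>x. x \<notin> M \<Longrightarrow> R x = 0" by auto
    have bR: "bounded_op M M R" by (rule positive_opD(1)[OF R(1) M])
    have "R (A x) = A (R x)" if "x \<in> M" for x
      using R(2)[OF that] R(2)[OF bounded_opD(1)[OF bR M that]] by simp
    then have "R (S x) = S (R x)" if "x \<in> M" for x using S(4)[OF bR _ that] by blast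
    then have "R x = S x" if "x \<in> M" for x
      using positive_op_sqrt_unique[OF R(1) S(1) M _ _ that] R(2) S(2) by simp
    then show "R = S" using R(3) S(3) by (intro ext) metis
  qed
  then show "positive_op M (op_sqrt M A)" "x \<in> M \<Longrightarrow> op_sqrt M A (op_sqrt M A x) = A x"
    "bounded_op M M C \<Longrightarrow> (\<And>x. x \<in> M \<Longrightarrow> C (A x) = A (C x)) \<Longrightarrow> x \<in> M \<Longrightarrow>
      C (op_sqrt M A x) = op_sqrt M A (C x)"
    using S(1,2,4) by simp_all
qed

lemma positive_op_cadj_comp:
  assumes A: "bounded_op M N A" and M: "closed_csubspace M" and N: "closed_csubspace N"
  shows "positive_op M (cadj M A \<circ> A)"
proof -
  have "cinner ((cadj M A \<circ> A) x) x = of_real (inner (A x) (A x))" if "x \<in> M" for x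
    by (simp add: cinner_cadj_left[OF A M that] cinner_self_of_real)
  then show ?thesis
    unfolding positive_op_def
    using bounded_op_compose[OF A bounded_op_cadj[OF A M]] by (auto simp: complex_nonneg_Reals_iff)
qed

lemma op_abs:
  assumes A: "bounded_op M N A" and M: "closed_csubspace M" and N: "closed_csubspace N"
  shows positive_op_abs: "positive_op M (op_abs M A)"
    and op_abs_op_abs: "x \<in> M \<Longrightarrow> op_abs M A (op_abs M A x) = cadj M A (A x)"
    and op_abs_commute: "bounded_op M M C \<Longrightarrow> (\<And>x. x \<in> M \<Longrightarrow> C (cadj M A (A x)) = cadj M A (A (C x))) \<Longrightarrow>
      x \<in> M \<Longrightarrow> C (op_abs M A x) = op_abs M A (C x)"
  using op_sqrt[OF positive_op_cadj_comp[OF A M N] M] unfolding op_abs_def by simp_all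

subsection \<open>Reducing subspaces\<close>

lemma bounded_op_restrict:
  assumes "bounded_op M N A" "L \<subseteq> M" "A ` L \<subseteq> K"
  shows "bounded_op L K A"
  using assms unfolding bounded_op_def by (auto 4 4)

lemma closed_csubspace_kernel:
  assumes A: "bounded_op M N A" and M: "closed_csubspace M"
  shows "closed_csubspace {x \<in> M. A x = 0}"
proof -
  have "closed {x \<in> M. A x = 0}"
    unfolding closed_sequential_limits
  proof safe
    fix f l assume f: "\<forall>n. f n \<in> {x \<in> M. A x = 0}" "f \<longlonglongrightarrow> l"
    then show l: "l \<in> M" using closed_csubspaceD(7)[OF M] closed_sequentially by blast
    have "(\<lambda>n. A (f n)) \<longlonglongrightarrow> A l"
      using f l by (intro bounded_op_tendsto[OF A M]) auto
    then show "A l = 0" using f(1) by (simp add: LIMSEQ_const_iff)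
  qed
  then show ?thesis
    unfolding closed_csubspace_def subspace_def
    using bounded_opD[OF A M] closed_csubspaceD[OF M] by auto
qed

text \<open>The adjoint of the inclusion of \<open>N\<close> into \<open>M\<close> is the orthogonal
  projection onto \<open>N\<close>.\<close>

lemma orthogonal_projection:
  assumes M: "closed_csubspace M" and N: "closed_csubspace N" "N \<subseteq> M" and x: "x \<in> M"
  shows "x - cadj N (\<lambda>x. x) x \<in> ocomplement M N"
proof -
  have id: "bounded_op N M (\<lambda>x. x)" by (rule bounded_op_restrict[OF bounded_op_id]) (use N in auto)
  have "cinner (x - cadj N (\<lambda>x. x) x) y = 0" if "y \<in> N" for y
    using cinner_cadj_left[OF id N(1) that] by (simp add: cinner_diff_left)
  then show ?thesis
    using x N(2) cadj_mem[OF id N(1), of x] unfolding ocomplement_def by (auto intro: closed_csubspaceD[OF M])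
qed

lemma orthogonal_decompose:
  assumes "closed_csubspace M" "closed_csubspace N" "N \<subseteq> M" "x \<in> M"
  obtains y z where "y \<in> N" "z \<in> ocomplement M N" "x = y + z"
proof -
  have "bounded_op N M (\<lambda>x. x)" by (rule bounded_op_restrict[OF bounded_op_id]) (use assms in auto)
  then show ?thesis
    using orthogonal_projection[OF assms] cadj_mem[OF _ assms(2)]
    by (intro that[of "cadj N (\<lambda>x. x) x" "x - cadj N (\<lambda>x. x) x"]) auto
qed

text \<open>The complement is the kernel of the orthogonal projection, so its closedness is that of
  a kernel.\<close>

lemma closed_csubspace_ocomplement:
  assumes M: "closed_csubspace M" and N: "closed_csubspace N" "N \<subseteq> M"
  shows "closed_csubspace (ocomplement M N)"
proof -
  have id: "bounded_op N M (\<lambda>x. x)" by (rule bounded_op_restrict[OF bounded_op_id]) (use N in auto)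
  have "cadj N (\<lambda>x. x) x = 0" if "x \<in> ocomplement M N" for x
    using that unfolding ocomplement_def
    by (intro cadj_eqI[OF id N(1)]) (auto simp: closed_csubspaceD[OF N(1)] cinner_commute[of _ x])
  then have "ocomplement M N = {x \<in> M. cadj N (\<lambda>x. x) x = 0}"
    using orthogonal_projection[OF M N] unfolding ocomplement_def by (auto; force)
  then show ?thesis using closed_csubspace_kernel[OF bounded_op_cadj[OF id N(1)] M] by simp
qed

lemma ocomplement_disjoint: "x \<in> N \<Longrightarrow> x \<in> ocomplement M N \<Longrightarrow> x = 0"
  unfolding ocomplement_def by fastforce

lemma ocomplement_ocomplement:
  assumes M: "closed_csubspace M" and N: "closed_csubspace N" "N \<subseteq> M"
  shows "ocomplement M (ocomplement M N) = N"
proof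
  show "N \<subseteq> ocomplement M (ocomplement M N)"
  proof
    fix x assume x: "x \<in> N"
    have "cinner x y = 0" if "y \<in> ocomplement M N" for y
    proof -
      have "cinner y x = 0" using that x unfolding ocomplement_def by blast
      then show ?thesis using cinner_commute[of x y] by simp
    qed
    then show "x \<in> ocomplement M (ocomplement M N)" using x N(2) unfolding ocomplement_def by auto
  qed
  show "ocomplement M (ocomplement M N) \<subseteq> N"
  proof
    fix x assume x: "x \<in> ocomplement M (ocomplement M N)"
    then have "x \<in> M" unfolding ocomplement_def by simp
    then obtain y z where yz: "y \<in> N" "z \<in> ocomplement M N" "x = y + z"
      using orthogonal_decompose[OF M N] by blast
    have "cinner y z = 0"
      using yz(1,2) cinner_commute[of y z] unfolding ocomplement_def by auto
    moreover have "cinner x z = 0" using x yz(2) unfolding ocomplement_def by blast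
    ultimately have "z = 0" unfolding yz(3) by (simp add: cinner_add_left)
    with yz show "x \<in> N" by simp
  qed
qed

lemma reducesI:
  assumes A: "bounded_op M M A" and M: "closed_csubspace M" and N: "closed_csubspace N" "N \<subseteq> M"
    and inv: "\<And>x. x \<in> N \<Longrightarrow> A x \<in> N" "\<And>x. x \<in> N \<Longrightarrow> cadj M A x \<in> N"
  shows "reduces M N A"
proof -
  have "A x \<in> ocomplement M N" if x: "x \<in> ocomplement M N" for x
  proof -
    have xM: "x \<in> M" using x unfolding ocomplement_def by simp
    have "cinner (A x) y = 0" if "y \<in> N" for y
      using x inv(2)[OF that] unfolding cinner_cadj_right[OF A M xM, symmetric] ocomplement_def by blast
    then show ?thesis using bounded_opD(1)[OF A M xM] unfolding ocomplement_def by blast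
  qed
  then show ?thesis unfolding reduces_def using N inv by auto
qed

lemma reduces_ocomplement:
  assumes "reduces M N A" "closed_csubspace M"
  shows "reduces M (ocomplement M N) A"
  using assms closed_csubspace_ocomplement[of M N] ocomplement_ocomplement[of M N]
  unfolding reduces_def by (auto simp: ocomplement_def)

lemma reduces_cadj_mem:
  assumes R: "reduces M N A" and A: "bounded_op M M A" and M: "closed_csubspace M" and x: "x \<in> N"
  shows "cadj M A x \<in> N"
proof -
  have N: "closed_csubspace N" "N \<subseteq> M" using R unfolding reduces_def by auto
  have "cinner (cadj M A x) y = 0" if y: "y \<in> ocomplement M N" for y
  proof -
    have yM: "y \<in> M" using y unfolding ocomplement_def by simp
    have "A y \<in> ocomplement M N" using R y unfolding reduces_def by blast
    then have "cinner (A y) x = 0" using x unfolding ocomplement_def by blast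
    then show ?thesis
      using cinner_cadj_left[OF A M yM, of x] cinner_commute[of x "A y"] by simp
  qed
  then have "cadj M A x \<in> ocomplement M (ocomplement M N)"
    using cadj_mem[OF A M] unfolding ocomplement_def by blast
  then show ?thesis using ocomplement_ocomplement[OF M N] by simp
qed

text \<open>On a reducing subspace the ambient adjoint already takes values in the subspace, so
  uniqueness identifies it with the adjoint of the restriction. All adjoints in the third condition
  can thus be computed in \<open>H2\<close>.\<close>

lemma reduces_restrict:
  assumes R: "reduces M N A" and A: "bounded_op M M A" and M: "closed_csubspace M"
  shows bounded_op_reduces: "bounded_op N N A"
    and cadj_reduces: "x \<in> N \<Longrightarrow> cadj N A x = cadj M A x"
proof -
  have N: "closed_csubspace N" "N \<subseteq> M" "A ` N \<subseteq> N" using R unfolding reduces_def by auto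
  show b: "bounded_op N N A" by (rule bounded_op_restrict[OF A N(2,3)])
  show "cadj N A x = cadj M A x" if "x \<in> N"
  proof (rule cadj_eqI[OF b N(1) reduces_cadj_mem[OF R A M that]])
    fix m assume "m \<in> N"
    then show "cinner (A m) x = cinner m (cadj M A x)"
      using cinner_cadj_right[OF A M] N(2) by auto
  qed
qed

lemma reduces_trivial:
  assumes "bounded_op M M A" "closed_csubspace M"
  shows "reduces M {0} A"
proof (rule reducesI[OF assms])
  show "closed_csubspace ({0}::'a set)"
    by (simp add: closed_csubspace_def)
qed (auto simp: bounded_opD[OF assms] closed_csubspaceD[OF assms(2)]
    bounded_opD(7)[OF bounded_op_cadj[OF assms] assms(2)])

lemma cadj_positive_op:
  assumes "positive_op M A" "closed_csubspace M" "x \<in> M"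
  shows "cadj M A x = A x"
  using positive_op_selfadjoint[OF assms(1,2) _ assms(3)]
  by (intro cadj_eqI[OF positive_opD(1)[OF assms(1,2)] assms(2)])
    (auto simp: bounded_opD(1)[OF positive_opD(1)[OF assms(1,2)] assms(2,3)])

text \<open>Take adjoints in A S = S A. This carries the commutation of \<open>Q\<close> with
  \<open>P\<close> and with \<open>D\<close> over to \<open>Qs\<close>.\<close>

lemma cadj_commute_selfadjoint:
  assumes A: "bounded_op M M A" and S: "bounded_op M M S" and M: "closed_csubspace M"
    and sa: "\<And>x y. x \<in> M \<Longrightarrow> y \<in> M \<Longrightarrow> cinner (S x) y = cinner x (S y)"
    and comm: "\<And>x. x \<in> M \<Longrightarrow> A (S x) = S (A x)" and x: "x \<in> M"
  shows "cadj M A (S x) = S (cadj M A x)"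
proof (rule cinner_ext[OF M])
  note SM = bounded_opD(1)[OF S M] and AM = bounded_opD(1)[OF A M] and cM = cadj_mem[OF A M]
  show "cadj M A (S x) \<in> M" "S (cadj M A x) \<in> M" by (simp_all add: cM SM)
  show "cinner m (cadj M A (S x)) = cinner m (S (cadj M A x))" if m: "m \<in> M" for m
  proof -
    have "cinner m (S (cadj M A x)) = cinner (A (S m)) x"
      using m x by (simp add: sa[symmetric] cM cinner_cadj_right[OF A M] SM)
    also have "\<dots> = cinner (A m) (S x)" using m x by (simp add: comm sa AM)
    finally show ?thesis using m by (simp add: cinner_cadj_right[OF A M])
  qed
qed

text \<open>With wandering subspace \<open>{0}\<close> this provides the zero shift summand.\<close>

lemma unilateral_shift_trivial:
  assumes A: "bounded_op M M A" and M: "closed_csubspace M"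
  shows "unilateral_shift {0} A"
proof -
  have 0: "closed_csubspace ({0}::'a set)" by (simp add: closed_csubspace_def)
  have b: "bounded_op {0} {0} A"
    by (rule bounded_op_reduces[OF reduces_trivial[OF A M] A M])
  have pow: "(A ^^ n) 0 = 0" for n
    by (induction n) (auto simp: bounded_opD(7)[OF A M])
  have "(\<Union>n. (A ^^ n) ` {0}) = {0}" by (auto simp: pow)
  then show ?thesis
    unfolding unilateral_shift_def
    using b 0 cadj_mem[OF b 0] by (auto simp: pow corthogonal_def intro!: exI[of _ "{0}"])
qed

subsection \<open>Operators of class Q\<close>

locale class_Q_operator =
  fixes H1 H2 :: "'a::complex_hilbert_space set" and T V E Q :: "'a \<Rightarrow> 'a"
  assumes decomp: "orth_decomp2 UNIV H1 H2" and class_Q: "class_Q H1 H2 T V E Q"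
begin

abbreviation "Qs \<equiv> cadj H2 Q"

definition P :: "'a \<Rightarrow> 'a" where
  "P y = cadj H2 E (E y)"

definition D :: "'a \<Rightarrow> 'a" where
  "D y = Qs (Q y) + P y - y"

lemma H1: "closed_csubspace H1" and H2: "closed_csubspace H2"
  and orth: "x \<in> H1 \<Longrightarrow> y \<in> H2 \<Longrightarrow> cinner x y = 0" "x \<in> H1 \<Longrightarrow> y \<in> H2 \<Longrightarrow> cinner y x = 0"
  using decomp unfolding orth_decomp2_def corthogonal_def
  by (auto simp: cinner_commute[of y x])

lemma split: obtains x1 x2 where "x1 \<in> H1" "x2 \<in> H2" "x = x1 + x2"
proof -
  have "x \<in> {x + y |x y. x \<in> H1 \<and> y \<in> H2}"
    using decomp unfolding orth_decomp2_def by blast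
  then show ?thesis using that by blast
qed

lemma T: "bounded_op UNIV UNIV T" and V: "bounded_op H1 H1 V" and E: "bounded_op H2 H1 E"
  and Q: "bounded_op H2 H2 Q"
  and T_apply: "x \<in> H1 \<Longrightarrow> y \<in> H2 \<Longrightarrow> T (x + y) = (V x + E y) + Q y"
  and V_isometry: "x \<in> H1 \<Longrightarrow> cadj H1 V (V x) = x" and VE: "y \<in> H2 \<Longrightarrow> cadj H1 V (E y) = 0"
  and Q_P: "y \<in> H2 \<Longrightarrow> Q (P y) = P (Q y)"
  and Q_quasinormal: "y \<in> H2 \<Longrightarrow> Q (Qs (Q y)) = Qs (Q (Q y))"
  using class_Q unfolding class_Q_def quasinormal_def P_def by auto

lemma UNIV_closed: "closed_csubspace (UNIV :: 'a set)"
  by (simp add: closed_csubspace_def)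

lemma bounded_QsQ: "bounded_op H2 H2 (\<lambda>y. Qs (Q y))"
  using bounded_op_compose[OF Q bounded_op_cadj[OF Q H2]] by (simp add: comp_def)

lemma bounded_P: "bounded_op H2 H2 P"
  using bounded_op_compose[OF E bounded_op_cadj[OF E H2]] by (simp add: comp_def P_def[abs_def])

lemma bounded_D: "bounded_op H2 H2 D"
  unfolding D_def[abs_def]
  by (rule bounded_op_diff[OF bounded_op_add[OF bounded_QsQ bounded_P H2] bounded_op_id H2])

lemmas lin_Q = bounded_opD[OF Q H2]
lemmas lin_Qs = bounded_opD[OF bounded_op_cadj[OF Q H2] H2]
lemmas lin_P = bounded_opD[OF bounded_P H2]
lemmas lin_D = bounded_opD[OF bounded_D H2]
lemmas memH2 = closed_csubspaceD[OF H2]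

lemma adj_Q: "x \<in> H2 \<Longrightarrow> cinner x (Qs y) = cinner (Q x) y" "x \<in> H2 \<Longrightarrow> cinner (Qs y) x = cinner y (Q x)"
  by (rule cinner_cadj_right[OF Q H2] cinner_cadj_left[OF Q H2], assumption)+

lemma adj_E: "x \<in> H2 \<Longrightarrow> cinner x (cadj H2 E y) = cinner (E x) y"
    "x \<in> H2 \<Longrightarrow> cinner (cadj H2 E y) x = cinner y (E x)"
  by (rule cinner_cadj_right[OF E H2] cinner_cadj_left[OF E H2], assumption)+

lemma QsQ_selfadjoint: "x \<in> H2 \<Longrightarrow> y \<in> H2 \<Longrightarrow> cinner (Qs (Q x)) y = cinner x (Qs (Q y))"
  by (simp add: adj_Q)

lemma P_selfadjoint: "x \<in> H2 \<Longrightarrow> y \<in> H2 \<Longrightarrow> cinner (P x) y = cinner x (P y)"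
  by (simp add: P_def adj_E)

lemma D_selfadjoint: "x \<in> H2 \<Longrightarrow> y \<in> H2 \<Longrightarrow> cinner (D x) y = cinner x (D y)"
  by (simp add: D_def P_selfadjoint QsQ_selfadjoint cinner_add_left cinner_add_right
      cinner_diff_left cinner_diff_right)

lemma Qs_P: "y \<in> H2 \<Longrightarrow> Qs (P y) = P (Qs y)"
  by (rule cadj_commute_selfadjoint[OF Q bounded_P H2 P_selfadjoint Q_P])

lemma Q_D: "y \<in> H2 \<Longrightarrow> Q (D y) = D (Q y)"
  by (simp add: D_def lin_Q lin_Qs lin_P memH2 Q_P Q_quasinormal)

lemma Qs_D: "y \<in> H2 \<Longrightarrow> Qs (D y) = D (Qs y)"
  by (rule cadj_commute_selfadjoint[OF Q bounded_D H2 D_selfadjoint Q_D])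

section \<open>Block computations: the defect operators of \<open>T\<close> and of its
  adjoint\<close>

lemma T_mem: "x \<in> H1 \<Longrightarrow> T x = V x" "y \<in> H2 \<Longrightarrow> T y = E y + Q y"
  using T_apply[of x 0] T_apply[of 0 y]
  by (auto simp: closed_csubspaceD(1)[OF H1] memH2 bounded_opD[OF V H1] bounded_opD[OF E H2] lin_Q)

text \<open>The adjoint of the block matrix is lower triangular: the values of \<open>V\<close> and
  \<open>E\<close> lie in \<open>H1\<close> and are orthogonal to \<open>y\<close>.\<close>

lemma cadj_T_H2: "y \<in> H2 \<Longrightarrow> cadj UNIV T y = Qs y"
proof (rule cadj_eqI[OF T UNIV_closed UNIV_I])
  fix m assume y: "y \<in> H2"
  obtain m1 m2 where m: "m1 \<in> H1" "m2 \<in> H2" "m = m1 + m2" by (rule split)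
  show "cinner (T m) y = cinner m (Qs y)"
    using m y bounded_opD(1)[OF V H1] bounded_opD(1)[OF E H2]
    by (simp add: T_apply cinner_add_left orth adj_Q lin_Qs)
qed

text \<open>V^* E = 0 and its adjoint E^* V = 0 remove the off-diagonal blocks; the diagonal ones
  are V^* V = I and Q^* Q + E^* E.\<close>

lemma cadj_T_T: "x \<in> H1 \<Longrightarrow> y \<in> H2 \<Longrightarrow> cadj UNIV T (T (x + y)) = x + (Qs (Q y) + P y)"
proof (rule cadj_eqI[OF T UNIV_closed UNIV_I])
  fix m assume xy: "x \<in> H1" "y \<in> H2"
  obtain m1 m2 where m: "m1 \<in> H1" "m2 \<in> H2" "m = m1 + m2" by (rule split)
  note V1 = bounded_opD(1)[OF V H1] and E1 = bounded_opD(1)[OF E H2]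
  have "cinner (V m1) (V x) = cinner m1 x"
    using cinner_cadj_right[OF V H1 m(1), of "V x"] V_isometry[OF xy(1)] by simp
  moreover have "cinner (V m1) (E y) = 0"
    using cinner_cadj_right[OF V H1 m(1), of "E y"] VE[OF xy(2)] by simp
  moreover have "cinner (E m2) (V x) = 0"
    using cinner_cadj_left[OF V H1 xy(1), of "E m2"] VE[OF m(2)] by simp
  ultimately show "cinner (T m) (T (x + y)) = cinner m (x + (Qs (Q y) + P y))"
    using m xy by (simp add: T_apply cinner_add_left cinner_add_right orth adj_Q adj_E V1 E1
        lin_Q lin_Qs lin_P[unfolded P_def] P_def)
qed

lemma defect_T: "x \<in> H1 \<Longrightarrow> y \<in> H2 \<Longrightarrow> defect_op UNIV T (x + y) = D y"
  unfolding defect_op_def by (simp add: cadj_T_T D_def)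

lemma D_QsQ: "y \<in> H2 \<Longrightarrow> Qs (Q (D y)) = D (Qs (Q y))"
  by (simp only: Q_D Qs_D lin_Q)

text \<open>The defining expression equals T^* (T^* T - I) T - (T^* T - I). The inner defect sees
  only the component \<open>Q y\<close> of \<open>T (x + y)\<close>, and \<open>Q\<close> moves past
  \<open>D\<close>.\<close>

lemma two_isometry_iff: "two_isometry UNIV T \<longleftrightarrow> (\<forall>y\<in>H2. Qs (Q (D y)) = D y)"
proof -
  have eq: "cadj UNIV T (cadj UNIV T (T (T (x + y)))) - 2 *\<^sub>R cadj UNIV T (T (x + y)) + (x + y)
      = Qs (Q (D y)) - D y" if xy: "x \<in> H1" "y \<in> H2" for x y
  proof -
    have "T (x + y) = (V x + E y) + Q y" by (rule T_apply[OF xy])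
    moreover have "V x + E y \<in> H1"
      by (intro closed_csubspaceD[OF H1] bounded_opD(1)[OF V H1] bounded_opD(1)[OF E H2] xy)
    ultimately have d: "defect_op UNIV T (T (x + y)) = Q (D y)"
      using defect_T lin_Q(1)[OF xy(2)] Q_D[OF xy(2)] by simp
    have "cadj UNIV T (defect_op UNIV T (T (x + y))) = Qs (Q (D y))"
      unfolding d using xy by (intro cadj_T_H2 lin_Q(1) lin_D(1))
    moreover have "cadj UNIV T (defect_op UNIV T (T (x + y)))
        = cadj UNIV T (cadj UNIV T (T (T (x + y)))) - cadj UNIV T (T (x + y))"
      unfolding defect_op_def
      by (rule bounded_opD(6)[OF bounded_op_cadj[OF T UNIV_closed] UNIV_closed UNIV_I UNIV_I])
    moreover have "cadj UNIV T (T (x + y)) - (x + y) = D y"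
      using defect_T[OF xy] unfolding defect_op_def .
    ultimately show ?thesis by (simp add: scaleR_2 algebra_simps)
  qed
  have "two_isometry UNIV T \<longleftrightarrow> (\<forall>x\<in>H1. \<forall>y\<in>H2.
      cadj UNIV T (cadj UNIV T (T (T (x + y)))) - 2 *\<^sub>R cadj UNIV T (T (x + y)) + (x + y) = 0)"
    unfolding two_isometry_def using T by (metis split UNIV_I)
  also have "\<dots> \<longleftrightarrow> (\<forall>x\<in>H1. \<forall>y\<in>H2. Qs (Q (D y)) - D y = 0)" by (simp only: eq cong: ball_cong)
  finally show ?thesis using closed_csubspaceD(1)[OF H1] by auto
qed

text \<open>Applying T T^* to \<open>D y\<close> leaves \<open>H2\<close> through the vector
  \<open>E (Qs (D y))\<close> of \<open>H1\<close>, but the outer defect operator annihilates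
  \<open>H1\<close>.\<close>

lemma defect_product:
  assumes "x \<in> H1" "y \<in> H2"
  shows "defect_op UNIV T (defect_op UNIV (cadj UNIV T) (defect_op UNIV T (x + y)))
    = D (Q (Qs (D y)) - D y)"
proof -
  let ?z = "D y"
  have z: "?z \<in> H2" by (rule lin_D(1)[OF assms(2)])
  have Qz: "Qs ?z \<in> H2" by (rule lin_Qs(1)[OF z])
  have "defect_op UNIV (cadj UNIV T) ?z = T (Qs ?z) - ?z"
    unfolding defect_op_def
    by (simp only: cadj_cadj[OF T UNIV_closed UNIV_closed UNIV_I] cadj_T_H2[OF z])
  also have "\<dots> = E (Qs ?z) + (Q (Qs ?z) - ?z)"
    using T_mem(2)[OF Qz] by simp
  finally show ?thesis
    using defect_T[OF bounded_opD(1)[OF E H2 Qz] memH2(3)[OF lin_Q(1)[OF Qz] z]]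
    by (simp only: defect_T[OF assms])
qed

text \<open>For \<open>B = Q Q\<^sup>* - I\<close>, which commutes with \<open>D\<close>, one has \<open>(B D)\<^sup>* (B D) = B (D B D)\<close>.\<close>

lemma D_QQs_D_zero_iff:
  "(\<forall>y\<in>H2. D (Q (Qs (D y)) - D y) = 0) \<longleftrightarrow> (\<forall>y\<in>H2. Q (Qs (D y)) = D y)"
proof safe
  fix y assume h: "\<forall>y\<in>H2. D (Q (Qs (D y)) - D y) = 0" and y: "y \<in> H2"
  define B where "B y = Q (Qs y) - y" for y
  have BM: "B u \<in> H2" if "u \<in> H2" for u unfolding B_def using that by (intro memH2 lin_Q lin_Qs)
  have saB: "cinner (B u) v = cinner u (B v)" if "u \<in> H2" "v \<in> H2" for u v
    unfolding B_def using that
    by (simp add: cinner_diff_left cinner_diff_right lin_Qs flip: adj_Q)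
  have comm: "D (B u) = B (D u)" if "u \<in> H2" for u
  proof -
    have "D (B u) = D (Q (Qs u)) - D u"
      unfolding B_def using that by (intro lin_D(6) lin_Q lin_Qs)
    also have "D (Q (Qs u)) = Q (Qs (D u))"
      using that by (simp only: Q_D[symmetric] Qs_D lin_Qs)
    finally show ?thesis by (simp only: B_def)
  qed
  have Dy: "D y \<in> H2" by (rule lin_D(1)[OF y])
  have "cinner (B (D y)) (B (D y)) = cinner (D (B y)) (B (D y))" by (simp only: comm[OF y])
  also have "\<dots> = cinner (B y) (D (B (D y)))" by (rule D_selfadjoint[OF BM[OF y] BM[OF Dy]])
  also have "D (B (D y)) = 0" unfolding B_def using h y by blast
  finally have "B (D y) = 0" by simp
  then show "Q (Qs (D y)) = D y" unfolding B_def by simp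
next
  fix y assume h: "\<forall>y\<in>H2. Q (Qs (D y)) = D y" and y: "y \<in> H2"
  then have "Q (Qs (D y)) = D y" by blast
  then show "D (Q (Qs (D y)) - D y) = 0" using lin_D(7) by simp
qed

lemma brownian_isometry_iff:
  "brownian_isometry UNIV T \<longleftrightarrow>
    (\<forall>y\<in>H2. Qs (Q (D y)) = D y) \<and> (\<forall>y\<in>H2. Q (Qs (D y)) = D y)"
proof -
  have "(\<forall>x\<in>UNIV. defect_op UNIV T (defect_op UNIV (cadj UNIV T) (defect_op UNIV T x)) = 0) \<longleftrightarrow>
    (\<forall>x\<in>H1. \<forall>y\<in>H2. defect_op UNIV T (defect_op UNIV (cadj UNIV T) (defect_op UNIV T (x + y))) = 0)"
    by (metis split UNIV_I)
  also have "\<dots> \<longleftrightarrow> (\<forall>x\<in>H1. \<forall>y\<in>H2. D (Q (Qs (D y)) - D y) = 0)"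
    by (simp only: defect_product cong: ball_cong)
  also have "\<dots> \<longleftrightarrow> (\<forall>y\<in>H2. D (Q (Qs (D y)) - D y) = 0)"
    using closed_csubspaceD(1)[OF H1] by auto
  finally show ?thesis
    unfolding brownian_isometry_def two_isometry_iff D_QQs_D_zero_iff by blast
qed

section \<open>The modulus of \<open>E\<close> and the decomposition of \<open>H2\<close>\<close>

lemmas absE = positive_op_abs[OF E H2 H1]
lemmas bounded_absE = positive_opD(1)[OF absE H2]

lemma absE_sq: "x \<in> H2 \<Longrightarrow> op_abs H2 E (op_abs H2 E x) = P x"
  unfolding P_def by (rule op_abs_op_abs[OF E H2 H1])

lemma Q_absE: "x \<in> H2 \<Longrightarrow> Q (op_abs H2 E x) = op_abs H2 E (Q x)"
  by (rule op_abs_commute[OF E H2 H1 Q Q_P[unfolded P_def]])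

text \<open>\<open>D\<close> commutes with \<open>P\<close>, the square of the modulus, and
  commutation passes to square roots.\<close>

lemma absE_D:
  assumes x: "x \<in> H2"
  shows "op_abs H2 E (D x) = D (op_abs H2 E x)"
proof -
  have "D (P u) = P (D u)" if "u \<in> H2" for u
    using that by (simp add: D_def lin_P lin_Q lin_Qs memH2 Q_P Qs_P)
  then show ?thesis using op_abs_commute[OF E H2 H1 bounded_D _ x] unfolding P_def by simp
qed

lemma abs_squares:
  assumes "x \<in> H2"
  shows "(op_abs H2 Q ^^ 2) x = Qs (Q x)" "(op_abs H2 Qs ^^ 2) x = Q (Qs x)"
    "(op_abs H2 E ^^ 2) x = P x"
  using assms op_abs_op_abs[OF Q H2 H2] op_abs_op_abs[OF bounded_op_cadj[OF Q H2] H2 H2] absE_sq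
    cadj_cadj[OF Q H2 H2] lin_Qs(1)
  by (simp_all add: numeral_2_eq_2)

lemma decomposition_if:
  assumes iso: "\<And>y. y \<in> H2 \<Longrightarrow> Qs (Q (D y)) = D y" and coiso: "\<And>y. y \<in> H2 \<Longrightarrow> Q (Qs (D y)) = D y"
  obtains Hu Hsi where "orth_decomp3 H2 Hu {0} Hsi"
    "\<And>M. M \<in> {Hu, {0}, Hsi} \<Longrightarrow> reduces H2 M Q \<and> reduces H2 M (op_abs H2 E)"
    "unitary_op Hu Q" "spherical_isometry Hsi Q (op_abs H2 E)"
proof -
  define Hsi where "Hsi = {x \<in> H2. D x = 0}"
  define Hu where "Hu = ocomplement H2 Hsi"
  have Hsi: "closed_csubspace Hsi" "Hsi \<subseteq> H2"
    unfolding Hsi_def using closed_csubspace_kernel[OF bounded_D H2] by auto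
  have Hu: "closed_csubspace Hu" "Hu \<subseteq> H2"
    using closed_csubspace_ocomplement[OF H2 Hsi] unfolding Hu_def by (auto simp: ocomplement_def)
  \<comment> \<open>The kernel of \<open>D\<close> is invariant under everything commuting with
    \<open>D\<close>; used for \<open>Q\<close>, its adjoint and the modulus of
    \<open>E\<close>.\<close>
  have inv: "C x \<in> Hsi" if C: "bounded_op H2 H2 C" "\<And>x. x \<in> H2 \<Longrightarrow> C (D x) = D (C x)" and x: "x \<in> Hsi" for C x
  proof -
    have x': "x \<in> H2" "D x = 0" using x unfolding Hsi_def by auto
    then have "D (C x) = 0" using C(2)[OF x'(1)] bounded_opD(7)[OF C(1) H2] by simp
    then show ?thesis using bounded_opD(1)[OF C(1) H2 x'(1)] unfolding Hsi_def by simp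
  qed
  have rQ: "reduces H2 Hsi Q"
    using inv[OF Q Q_D] inv[OF bounded_op_cadj[OF Q H2] Qs_D] by (intro reducesI[OF Q H2 Hsi])
  have rE: "reduces H2 Hsi (op_abs H2 E)"
    using inv[OF bounded_absE absE_D] Hsi(2)
    by (intro reducesI[OF bounded_absE H2 Hsi]) (auto simp: cadj_positive_op[OF absE H2])
  have rQ': "reduces H2 Hu Q" and rE': "reduces H2 Hu (op_abs H2 E)"
    unfolding Hu_def by (intro reduces_ocomplement rQ rE H2)+
  have zero: "x = 0" if "x \<in> Hu" "D x = 0" for x
    using that Hu(2) ocomplement_disjoint[of x Hsi H2] unfolding Hu_def Hsi_def by auto
  note QsHu = reduces_cadj_mem[OF rQ' Q H2]
  have QHu: "Q x \<in> Hu" if "x \<in> Hu" for x using rQ' that unfolding reduces_def by blast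
  \<comment> \<open>\<open>D\<close> is injective on \<open>Hu\<close>, and it kills this vector of
    \<open>Hu\<close> because it commutes with \<open>Q\<close> and \<open>Qs\<close>.\<close>
  have "Qs (Q x) - x = 0" if x: "x \<in> Hu" for x
  proof (rule zero)
    show "Qs (Q x) - x \<in> Hu" using x by (intro closed_csubspaceD[OF Hu(1)] QsHu QHu)
    have xH: "x \<in> H2" using x Hu(2) by blast
    then have "D (Qs (Q x) - x) = D (Qs (Q x)) - D x" by (intro lin_D(6) lin_Qs lin_Q)
    then show "D (Qs (Q x) - x) = 0"
      using iso[OF xH] by (simp only: D_QsQ[OF xH, symmetric] diff_self)
  qed
  moreover have "Q (Qs x) - x = 0" if x: "x \<in> Hu" for x
  proof (rule zero)
    show "Q (Qs x) - x \<in> Hu" using x by (intro closed_csubspaceD[OF Hu(1)] QsHu QHu)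
    have xH: "x \<in> H2" using x Hu(2) by blast
    then have "D (Q (Qs x) - x) = D (Q (Qs x)) - D x" by (intro lin_D(6) lin_Qs lin_Q)
    then show "D (Q (Qs x) - x) = 0"
      using coiso[OF xH]
      by (simp only: Q_D[OF lin_Qs(1)[OF xH], symmetric] Qs_D[OF xH, symmetric] diff_self)
  qed
  ultimately have "unitary_op Hu Q"
    unfolding unitary_op_def
    using bounded_op_reduces[OF rQ' Q H2] cadj_reduces[OF rQ' Q H2] QHu by simp
  moreover have "spherical_isometry Hsi Q (op_abs H2 E)"
    unfolding spherical_isometry_def
  proof (intro conjI ballI)
    show "bounded_op Hsi Hsi Q" "bounded_op Hsi Hsi (op_abs H2 E)"
      by (rule bounded_op_reduces[OF rQ Q H2] bounded_op_reduces[OF rE bounded_absE H2])+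
    fix x assume x: "x \<in> Hsi"
    then have xH: "x \<in> H2" and Dx: "D x = 0" unfolding Hsi_def by auto
    have Qx: "Q x \<in> Hsi" and Ex: "op_abs H2 E x \<in> Hsi" using rQ rE x unfolding reduces_def by auto
    show "Q (op_abs H2 E x) = op_abs H2 E (Q x)" by (rule Q_absE[OF xH])
    \<comment> \<open>The modulus is selfadjoint and \<open>Hsi\<close> reduces it, so the second
      term of the spherical identity is \<open>P x\<close> and the identity becomes
      \<open>D x = 0\<close>.\<close>
    have "cadj Hsi (op_abs H2 E) (op_abs H2 E x) = P x"
      using Ex Hsi(2) absE_sq[OF xH]
      by (auto simp: cadj_reduces[OF rE bounded_absE H2] cadj_positive_op[OF absE H2])
    then show "cadj Hsi Q (Q x) + cadj Hsi (op_abs H2 E) (op_abs H2 E x) = x"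
      using Dx by (simp add: D_def cadj_reduces[OF rQ Q H2 Qx])
  qed
  moreover have "orth_decomp3 H2 Hu {0} Hsi"
  proof -
    have "x \<in> {x + y + z |x y z. x \<in> Hu \<and> y \<in> {0} \<and> z \<in> Hsi}" if x: "x \<in> H2" for x
    proof -
      obtain y z where "y \<in> Hsi" "z \<in> Hu" "x = y + z"
        using orthogonal_decompose[OF H2 Hsi x] unfolding Hu_def by blast
      then show ?thesis by (force simp: add.commute)
    qed
    moreover have "corthogonal Hu Hsi" unfolding corthogonal_def Hu_def ocomplement_def by blast
    ultimately show ?thesis
      unfolding orth_decomp3_def using Hu Hsi
      by (auto simp: corthogonal_def closed_csubspace_def[of "{0}"] intro!: memH2)
  qed
  ultimately show ?thesis
    using that[of Hu Hsi] rQ rE rQ' rE' reduces_trivial[OF Q H2] reduces_trivial[OF bounded_absE H2] by blast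
qed

text \<open>On \<open>Hs\<close> one has Q^* Q = I and E^* E = 0, and on \<open>Hsi\<close> the
  spherical identity is D = 0. Hence only the component in \<open>Hu\<close> contributes to
  \<open>D y\<close>.\<close>

lemma decomposition_imp:
  assumes d: "orth_decomp3 H2 Hu Hs Hsi"
    and red: "\<And>M. M \<in> {Hu, Hs, Hsi} \<Longrightarrow> reduces H2 M Q \<and> reduces H2 M (op_abs H2 E)"
    and u: "unitary_op Hu Q" and s: "\<And>x. x \<in> Hs \<Longrightarrow> cadj Hs Q (Q x) = x"
    and si: "spherical_isometry Hsi Q (op_abs H2 E)" and E0: "\<And>x. x \<in> Hs \<Longrightarrow> op_abs H2 E x = 0"
    and y: "y \<in> H2"
  shows "Qs (Q (D y)) = D y" "Q (Qs (D y)) = D y"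
proof -
  have sub: "M \<subseteq> H2" "x \<in> M \<Longrightarrow> Q x \<in> M" "x \<in> M \<Longrightarrow> op_abs H2 E x \<in> M"
    "x \<in> M \<Longrightarrow> cadj M Q x = Qs x" "x \<in> M \<Longrightarrow> cadj M (op_abs H2 E) x = op_abs H2 E x"
    if "M \<in> {Hu, Hs, Hsi}" for M x
  proof -
    have rQ: "reduces H2 M Q" and rE: "reduces H2 M (op_abs H2 E)" using red[OF that] by auto
    show "M \<subseteq> H2" "x \<in> M \<Longrightarrow> Q x \<in> M" "x \<in> M \<Longrightarrow> op_abs H2 E x \<in> M"
      using rQ rE unfolding reduces_def by auto
    then show "x \<in> M \<Longrightarrow> cadj M Q x = Qs x" "x \<in> M \<Longrightarrow> cadj M (op_abs H2 E) x = op_abs H2 E x"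
      by (auto simp: cadj_reduces[OF rQ Q H2] cadj_reduces[OF rE bounded_absE H2]
          cadj_positive_op[OF absE H2])
  qed
  obtain a b c where abc: "a \<in> Hu" "b \<in> Hs" "c \<in> Hsi" "y = a + b + c"
    using d y unfolding orth_decomp3_def by blast
  have abcH: "a \<in> H2" "b \<in> H2" "c \<in> H2" using abc sub(1) by auto
  have "Qs (Q b) = b" using s[OF abc(2)] sub(4)[of Hs "Q b"] sub(2)[of Hs b] abc(2) by simp
  moreover have "P b = 0"
    using absE_sq[OF abcH(2)] E0[OF abc(2)] bounded_opD(7)[OF bounded_absE H2] by simp
  ultimately have Db: "D b = 0" by (simp add: D_def)
  have "cadj Hsi Q (Q c) + cadj Hsi (op_abs H2 E) (op_abs H2 E c) = c"
    using si abc(3) unfolding spherical_isometry_def by blast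
  then have Dc: "D c = 0"
    using sub(2-5)[of Hsi] abc(3) absE_sq[OF abcH(3)] by (simp add: D_def)
  have "D (a + b + c) = D a + D b + D c"
    using abcH by (simp only: lin_D(2) memH2(2))
  then have Dy: "D y = D a" using Db Dc abc(4) by (simp only: add_0_right)
  have iso: "Qs (Q x) = x" if "x \<in> Hu" for x
    using u that sub(2,4)[of Hu] unfolding unitary_op_def by auto
  have coiso: "Q (Qs x) = x" if "x \<in> Hu" for x
    using u that sub(4)[of Hu] unfolding unitary_op_def by auto
  \<comment> \<open>On \<open>Hu\<close> the isometry of \<open>Q\<close> reduces \<open>D\<close>
    to the squared modulus of \<open>E\<close>, which keeps \<open>Hu\<close> invariant; so
    \<open>D y\<close> lies where \<open>Q\<close> is unitary.\<close>
  have "D a = op_abs H2 E (op_abs H2 E a)"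
    using iso[OF abc(1)] absE_sq[OF abcH(1)] by (simp add: D_def)
  also have "\<dots> \<in> Hu" using abc(1) sub(3)[of Hu] by blast
  finally have "D y \<in> Hu" using Dy by (simp only:)
  then show "Qs (Q (D y)) = D y" "Q (Qs (D y)) = D y" using iso coiso by blast+
qed

end

theorem theorem8p3:
  fixes H1 H2 :: "'a::complex_hilbert_space set"
    and T V E Q :: "'a \<Rightarrow> 'a"
  assumes decomp: "orth_decomp2 UNIV H1 H2"
    and nontrivial: "H1 \<noteq> {0}" "H2 \<noteq> {0}"
    and T: "class_Q H1 H2 T V E Q"
  defines "cond_i \<equiv> brownian_isometry UNIV T"
    and "cond_ii \<equiv>
      (\<forall>x\<in>H2. let y = (op_abs H2 Q ^^ 2) x + (op_abs H2 E ^^ 2) x - x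
               in (op_abs H2 Q ^^ 2) y - y = 0) \<and>
      (\<forall>x\<in>H2. let y = (op_abs H2 Q ^^ 2) x + (op_abs H2 E ^^ 2) x - x
               in (op_abs H2 (cadj H2 Q) ^^ 2) y - y = 0)"
    and "cond_iii \<equiv>
      (\<exists>Hu Hs Hsi. orth_decomp3 H2 Hu Hs Hsi \<and>
        (\<forall>M \<in> {Hu, Hs, Hsi}. reduces H2 M Q \<and> reduces H2 M (op_abs H2 E)) \<and>
        unitary_op Hu Q \<and> unilateral_shift Hs Q \<and>
        spherical_isometry Hsi Q (op_abs H2 E) \<and>
        (\<forall>x\<in>Hs. op_abs H2 E x = 0))"
  shows "(cond_i \<longleftrightarrow> cond_ii) \<and> (cond_ii \<longleftrightarrow> cond_iii)"
proof -
  interpret class_Q_operator H1 H2 T V E Q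
    by unfold_locales (fact decomp, fact T)
  \<comment> \<open>All three conditions are compared with this pair of equations. Once squares of
    moduli are replaced by \<open>abs_squares\<close>, the second condition is the same pair with
    \<open>D\<close> unfolded.\<close>
  define core where
    "core \<longleftrightarrow> (\<forall>y\<in>H2. Qs (Q (D y)) = D y) \<and> (\<forall>y\<in>H2. Q (Qs (D y)) = D y)"
  have i: "cond_i \<longleftrightarrow> core"
    unfolding cond_i_def core_def by (rule brownian_isometry_iff)
  have ii: "cond_ii \<longleftrightarrow> core"
    unfolding cond_ii_def core_def Let_def
    by (simp add: abs_squares lin_D(1) flip: D_def cong: ball_cong)
  have "cond_iii" if core
  proof -
    obtain Hu Hsi where "orth_decomp3 H2 Hu {0} Hsi"
      "\<And>M. M \<in> {Hu, {0}, Hsi} \<Longrightarrow> reduces H2 M Q \<and> reduces H2 M (op_abs H2 E)"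
      "unitary_op Hu Q" "spherical_isometry Hsi Q (op_abs H2 E)"
      using decomposition_if \<open>core\<close> unfolding core_def by blast
    moreover have "unilateral_shift {0} Q" by (rule unilateral_shift_trivial[OF Q H2])
    moreover have "\<forall>x\<in>{0}. op_abs H2 E x = 0"
      using bounded_opD(7)[OF bounded_absE H2] by simp
    ultimately show ?thesis unfolding cond_iii_def by blast
  qed
  moreover have "core" if "cond_iii"
  proof -
    obtain Hu Hs Hsi where h: "orth_decomp3 H2 Hu Hs Hsi"
      "\<And>M. M \<in> {Hu, Hs, Hsi} \<Longrightarrow> reduces H2 M Q \<and> reduces H2 M (op_abs H2 E)"
      "unitary_op Hu Q" "unilateral_shift Hs Q" "spherical_isometry Hsi Q (op_abs H2 E)"
      "\<And>x. x \<in> Hs \<Longrightarrow> op_abs H2 E x = 0"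
      using \<open>cond_iii\<close> unfolding cond_iii_def by blast
    have "\<And>x. x \<in> Hs \<Longrightarrow> cadj Hs Q (Q x) = x" using h(4) unfolding unilateral_shift_def by blast
    from decomposition_imp[OF h(1,2,3) this h(5,6)] show ?thesis unfolding core_def by blast
  qed
  ultimately show ?thesis using i ii by blast
qed

end
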